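(* Let $g_1,\dots,g_m\in\mathbb{R}[x]=\mathbb{R}[x_1,\dots,x_n]$, let $K:=\{x\in\mathbb{R}^n : g_j(x)\ge 0,\ j=1,\dots,m\}$, and let $f\in\mathbb{R}[x]$ be nonnegative on $K$. Then, for every $\epsilon>0$, there exist nonnegative scalars $\lambda_1,\dots,\lambda_m$ such that, for all $r\in\mathbb{N}$ sufficiently large, $$f+\epsilon\theta_r+\epsilon\varphi_r\,=\,q_\epsilon-\sum_{j=1}^m\lambda_j\,(g_j-z_j^2)^2$$ for some sum of squares polynomial $q_\epsilon\in\mathbb{R}[x,z]=\mathbb{R}[x_1,\dots,x_n,z_1,\dots,z_m]$ (which may depend on $r$). Moreover, for such $q_\epsilon$, everywhere on $K$ the polynomial $$x\mapsto f(x)+\epsilon\sum_{k=0}^r\sum_{i=1}^n\frac{x_i^{2k}}{k!}+\epsilon\sum_{k=0}^r\sum_{j=1}^m\frac{g_j(x)^k}{k!}$$ coincides with the nonnegative function $x\mapsto q_\epsilon\big(x,\sqrt{g_1(x)},\dots,\sqrt{g_m(x)}\big)$.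
   Context: For $r\in\mathbb{N}=\{0,1,2,\dots\}$, $\theta_r\in\mathbb{R}[x]$ and $\varphi_r\in\mathbb{R}[z]=\mathbb{R}[z_1,\dots,z_m]$ are the polynomials $\theta_r(x):=\sum_{k=0}^{r}\sum_{i=1}^n \frac{x_i^{2k}}{k!}$ and $\varphi_r(z):=\sum_{k=0}^{r}\sum_{j=1}^m \frac{z_j^{2k}}{k!}$. A sum of squares polynomial in $\mathbb{R}[x,z]$ is a finite sum of squares of elements of $\mathbb{R}[x,z]$. *)

theory Defs
  imports "HOL-Analysis.Analysis" "HOL-Library.Poly_Mapping"
begin

text \<open>
  The polynomial ring over the reals in the variables \<open>'v\<close>: finitely supported coefficient
  functions on monomials, a monomial being a finitely supported exponent function.
  Multiplication is convolution (instance of class \<open>comm_ring_1\<close> in \<open>Poly_Mapping\<close>).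
\<close>
type_synonym 'v mpoly = "('v \<Rightarrow>\<^sub>0 nat) \<Rightarrow>\<^sub>0 real"

definition Const :: "real \<Rightarrow> 'v mpoly" where
  "Const c = Poly_Mapping.single 0 c"

definition Var :: "'v \<Rightarrow> 'v mpoly" where
  "Var v = Poly_Mapping.single (Poly_Mapping.single v 1) 1"

text \<open>
  Evaluation in a commutative ring \<open>'b\<close>, with the coefficients mapped by \<open>h\<close> and the
  variables mapped by \<open>s\<close>.
\<close>
definition subst :: "(real \<Rightarrow> 'b::comm_ring_1) \<Rightarrow> ('v \<Rightarrow> 'b) \<Rightarrow> 'v mpoly \<Rightarrow> 'b" where
  "subst h s p = (\<Sum>t\<in>Poly_Mapping.keys p. h (Poly_Mapping.lookup p t) *
     (\<Prod>v\<in>Poly_Mapping.keys t. s v ^ Poly_Mapping.lookup t v))"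

definition eval :: "'v mpoly \<Rightarrow> ('v \<Rightarrow> real) \<Rightarrow> real" where
  "eval p a = subst (\<lambda>c. c) a p"

definition rename :: "('v \<Rightarrow> 'w) \<Rightarrow> 'v mpoly \<Rightarrow> 'w mpoly" where
  "rename \<rho> p = subst Const (\<lambda>v. Var (\<rho> v)) p"

text \<open>
  The ring of polynomials in \<open>(x, z)\<close> is \<open>('n + 'm) mpoly\<close>; the rings in \<open>x\<close> alone and in
  \<open>z\<close> alone are \<open>'n mpoly\<close> and \<open>'m mpoly\<close>, embedded as follows.
\<close>
abbreviation in_x :: "'n mpoly \<Rightarrow> ('n + 'm) mpoly" where
  "in_x \<equiv> rename Inl"

abbreviation in_z :: "'m mpoly \<Rightarrow> ('n + 'm) mpoly" where
  "in_z \<equiv> rename Inr"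

definition sum_of_squares :: "'v mpoly \<Rightarrow> bool" where
  "sum_of_squares p \<longleftrightarrow> (\<exists>qs :: 'v mpoly list. p = (\<Sum>q\<leftarrow>qs. q\<^sup>2))"

definition \<theta> :: "nat \<Rightarrow> 'n::finite mpoly" where
  "\<theta> r = (\<Sum>k\<le>r. \<Sum>i\<in>UNIV. Const (1 / fact k) * Var i ^ (2 * k))"

definition \<phi> :: "nat \<Rightarrow> 'm::finite mpoly" where
  "\<phi> r = (\<Sum>k\<le>r. \<Sum>j\<in>UNIV. Const (1 / fact k) * Var j ^ (2 * k))"

definition feasible_set :: "('m::finite \<Rightarrow> 'n::finite mpoly) \<Rightarrow> (real ^ 'n) set" where
  "feasible_set g = {x. \<forall>j. eval (g j) (($) x) \<ge> 0}"

definition certificate ::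
  "'n::finite mpoly \<Rightarrow> ('m::finite \<Rightarrow> 'n mpoly) \<Rightarrow> real \<Rightarrow> ('m \<Rightarrow> real) \<Rightarrow> nat \<Rightarrow>
    ('n + 'm) mpoly \<Rightarrow> bool" where
  "certificate f g \<epsilon> l r q \<longleftrightarrow>
     in_x f + Const \<epsilon> * in_x (\<theta> r) + Const \<epsilon> * in_z (\<phi> r) =
     q - (\<Sum>j\<in>UNIV. Const (l j) * (in_x (g j) - (Var (Inr j))\<^sup>2)\<^sup>2)"

end

theory Submission
  imports Defs
begin

text \<open>
  Write \<open>p \<preceq> q\<close> if \<open>q - p\<close> is a sum of squares. By compactness some penalty \<open>\<lambda>\<close> makes
  \<open>f + (\<epsilon>/2) \<Theta> + \<lambda> \<Sum>\<^sub>j (g\<^sub>j - z\<^sub>j\<^sup>2)\<^sup>2\<close> nonnegative everywhere, where \<open>\<Theta>\<close> is the perturbation of a fixed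
  high order in all variables. It remains to show that a globally nonnegative polynomial \<open>p\<close> is
  a sum of squares after adding \<open>\<epsilon> \<theta>\<^sub>r\<close>. Instead of the moment problem with Carleman's condition,
  the proof constructs the squares. Substituting \<open>sin (2 a x) / (2 a)\<close> for every variable \<open>x\<close>
  changes \<open>p\<close> little for small \<open>a\<close>. As the functions \<open>(1 \<plusminus> sin (2 a x)) / 2\<close> are halves of the squares
  of \<open>sin (a x) \<plusminus> cos (a x)\<close>, the Bernstein approximation of \<open>p\<close> on the range of the substitution
  is a sum of squares. All functions involved have exponential type, so the errors, also those
  made by replacing \<open>sin\<close> and \<open>cos\<close> by polynomials, are dominated with respect to \<open>\<preceq>\<close> by small
  multiples of truncations of \<open>exp (b \<Sum>\<^sub>i x\<^sub>i\<^sup>2)\<close>, which in turn lie below \<open>\<theta>\<^sub>r\<close>.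
\<close>

section \<open>The polynomial ring and evaluation homomorphisms\<close>

lemma Const_0 [simp]: "Const 0 = 0" by (simp add: Const_def)
lemma Const_1 [simp]: "Const 1 = 1" by (simp add: Const_def)
lemma Const_add: "Const (a + b) = Const a + Const b" by (simp add: Const_def single_add)
lemma Const_mult: "Const (a * b) = Const a * Const b" by (simp add: Const_def mult_single)
lemma Const_uminus: "Const (- a) = - Const a" by (simp add: Const_def single_uminus)
lemma Const_diff: "Const (a - b) = Const a - Const b" by (simp add: Const_def single_diff)
lemma Const_power: "Const (a ^ n) = Const a ^ n" by (induction n) (simp_all add: Const_mult)
lemma Const_of_nat: "Const (real n) = of_nat n"
  by (simp add: Const_def)
lemma Const_numeral [simp]: "Const (numeral n) = numeral n"
  by (simp add: Const_def)
lemma Const_sum: "Const (sum f A) = (\<Sum>x\<in>A. Const (f x))"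
  by (induction A rule: infinite_finite_induct) (simp_all add: Const_add)

lemma Const_prod: "Const (prod f A) = (\<Prod>x\<in>A. Const (f x))"
  by (induction A rule: infinite_finite_induct) (simp_all add: Const_mult)

lemma Const_half_mult_2: "Const (1/2) * (2 * q) = q"
  unfolding Const_numeral [symmetric] mult.assoc [symmetric] Const_mult [symmetric] by simp

lemma Const_mult_single: "Const c * Poly_Mapping.single t d = Poly_Mapping.single t (c * d)"
  by (simp add: Const_def mult_single)

lemma Var_power: "Var v ^ n = Poly_Mapping.single (Poly_Mapping.single v n) 1"
  by (induction n) (simp_all add: Var_def mult_single single_add [symmetric])

lemma poly_mapping_expand:
  fixes p :: "'a \<Rightarrow>\<^sub>0 'b::comm_monoid_add"
  shows "p = (\<Sum>t\<in>Poly_Mapping.keys p. Poly_Mapping.single t (Poly_Mapping.lookup p t))"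
  by (rule poly_mapping_eqI) (simp add: lookup_sum lookup_single when_def in_keys_iff)

lemma single_prod_Var:
  fixes t :: "'v \<Rightarrow>\<^sub>0 nat"
  shows "Poly_Mapping.single t 1 = (\<Prod>v\<in>Poly_Mapping.keys t. Var v ^ Poly_Mapping.lookup t v)"
proof -
  have "(\<Prod>v\<in>A. Poly_Mapping.single (Poly_Mapping.single v (Poly_Mapping.lookup t v)) (1::real))
      = Poly_Mapping.single (\<Sum>v\<in>A. Poly_Mapping.single v (Poly_Mapping.lookup t v)) 1"
    if "finite A" for A
    using that by (induction A) (auto simp: mult_single)
  then show ?thesis
    by (simp add: Var_power poly_mapping_expand [of t, symmetric])
qed

lemma subst_Const_Var: "subst Const Var p = p"
  unfolding subst_def single_prod_Var [symmetric] Const_mult_single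
  by (simp add: poly_mapping_expand [symmetric])

lemma prod_keys_UNIV:
  fixes t :: "'v::finite \<Rightarrow>\<^sub>0 nat" and s :: "'v \<Rightarrow> 'b::comm_monoid_mult"
  shows "(\<Prod>v\<in>Poly_Mapping.keys t. s v ^ Poly_Mapping.lookup t v) = (\<Prod>v\<in>UNIV. s v ^ Poly_Mapping.lookup t v)"
  by (rule prod.mono_neutral_left) (auto simp: in_keys_iff)

text \<open>Evaluation at real points and renaming of variables are both substitutions along a ring
  homomorphism from the reals, namely the identity and \<open>Const\<close>. The computation rules
  are proved once for both.\<close>

locale real_hom =
  fixes h :: "real \<Rightarrow> 'b::comm_ring_1"
  assumes h_add: "h (a + b) = h a + h b"
    and h_mult: "h (a * b) = h a * h b"
    and h_1: "h 1 = 1"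
begin

lemma h_0: "h 0 = 0"
  using h_add [of 0 0] by simp

text \<open>Exponents outside the support contribute \<open>h 0 = 0\<close>; hence \<open>p\<close>,
  \<open>q\<close> and \<open>p + q\<close> can all be summed over one index set.\<close>

lemma subst_superset:
  assumes "finite A" "Poly_Mapping.keys p \<subseteq> A"
  shows "subst h s p = (\<Sum>t\<in>A. h (Poly_Mapping.lookup p t) *
     (\<Prod>v\<in>Poly_Mapping.keys t. s v ^ Poly_Mapping.lookup t v))"
  unfolding subst_def by (rule sum.mono_neutral_left) (use assms in \<open>auto simp: in_keys_iff h_0\<close>)

lemma subst_0: "subst h s 0 = 0"
  by (simp add: subst_def)

lemma subst_add: "subst h s (p + q) = subst h s p + subst h s q"
proof -
  let ?A = "Poly_Mapping.keys p \<union> Poly_Mapping.keys q"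
  have "Poly_Mapping.keys (p + q) \<subseteq> ?A" by (rule keys_add)
  then show ?thesis
    by (simp add: subst_superset [of ?A] lookup_add h_add distrib_right sum.distrib)
qed

lemma subst_uminus: "subst h s (- p) = - subst h s p"
  using subst_add [of s p "- p"] by (simp add: subst_0 eq_neg_iff_add_eq_0 add.commute)

lemma subst_diff: "subst h s (p - q) = subst h s p - subst h s q"
  using subst_add [of s p "- q"] by (simp add: subst_uminus)

lemma subst_sum: "subst h s (sum P A) = (\<Sum>x\<in>A. subst h s (P x))"
  by (induction A rule: infinite_finite_induct) (simp_all add: subst_0 subst_add)

lemma subst_single:
  "subst h s (Poly_Mapping.single t c) = h c * (\<Prod>v\<in>Poly_Mapping.keys t. s v ^ Poly_Mapping.lookup t v)"
  by (subst subst_superset [of "{t}"]) auto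

lemma prod_power_add:
  "(\<Prod>v\<in>Poly_Mapping.keys (t + t'). s v ^ Poly_Mapping.lookup (t + t') v) =
    (\<Prod>v\<in>Poly_Mapping.keys t. s v ^ Poly_Mapping.lookup t v) * (\<Prod>v\<in>Poly_Mapping.keys t'. s v ^ Poly_Mapping.lookup t' v)"
  for t t' :: "'v \<Rightarrow>\<^sub>0 nat" and s :: "'v \<Rightarrow> 'b"
proof -
  let ?A = "Poly_Mapping.keys t \<union> Poly_Mapping.keys t'"
  have *: "(\<Prod>v\<in>Poly_Mapping.keys u. s v ^ Poly_Mapping.lookup u v) = (\<Prod>v\<in>?A. s v ^ Poly_Mapping.lookup u v)"
    if "Poly_Mapping.keys u \<subseteq> ?A" for u
    by (rule prod.mono_neutral_left) (use that in \<open>auto simp: in_keys_iff\<close>)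
  have "(\<Prod>v\<in>Poly_Mapping.keys (t + t'). s v ^ Poly_Mapping.lookup (t + t') v) =
      (\<Prod>v\<in>?A. s v ^ Poly_Mapping.lookup (t + t') v)"
    by (rule *) (rule keys_add)
  then show ?thesis
    by (simp add: * [of t] * [of t'] lookup_add power_add prod.distrib)
qed

lemma subst_mult: "subst h s (p * q) = subst h s p * subst h s q"
proof -
  have "p * q = (\<Sum>t\<in>Poly_Mapping.keys p. \<Sum>t'\<in>Poly_Mapping.keys q.
      Poly_Mapping.single (t + t') (Poly_Mapping.lookup p t * Poly_Mapping.lookup q t'))"
    by (subst (1) poly_mapping_expand [of p], subst (1) poly_mapping_expand [of q])
      (simp add: sum_product mult_single)
  then have "subst h s (p * q) = (\<Sum>t\<in>Poly_Mapping.keys p. \<Sum>t'\<in>Poly_Mapping.keys q.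
      h (Poly_Mapping.lookup p t) * (\<Prod>v\<in>Poly_Mapping.keys t. s v ^ Poly_Mapping.lookup t v) *
      (h (Poly_Mapping.lookup q t') * (\<Prod>v\<in>Poly_Mapping.keys t'. s v ^ Poly_Mapping.lookup t' v)))"
    by (simp add: subst_sum subst_single prod_power_add h_mult mult_ac)
  then show ?thesis
    by (simp add: subst_def sum_product)
qed

lemma subst_Const: "subst h s (Const c) = h c"
  by (simp add: Const_def subst_single)

lemma subst_Var: "subst h s (Var v) = s v"
  by (simp add: Var_def subst_single h_1)

lemma subst_power: "subst h s (p ^ n) = subst h s p ^ n"
  by (induction n) (use subst_Const [of s 1] in \<open>simp_all add: subst_mult h_1\<close>)

lemmas subst_simps = subst_0 subst_add subst_uminus subst_diff subst_sum subst_mult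
  subst_Const subst_Var subst_power

end

interpretation id_hom: real_hom "\<lambda>c. c" by unfold_locales auto
interpretation Const_hom: real_hom Const by unfold_locales (auto simp: Const_add Const_mult)

lemmas eval_simps = id_hom.subst_simps [folded eval_def]

lemmas rename_simps = Const_hom.subst_simps [where s = "\<lambda>v. Var (f v)", folded rename_def] for f

lemma eval_prod: "eval (prod P A) a = (\<Prod>x\<in>A. eval (P x) a)"
  using id_hom.subst_Const [of a 1]
  by (induction A rule: infinite_finite_induct) (simp_all add: eval_simps, simp_all add: eval_def)

lemma eval_rename: "eval (rename \<rho> p) a = eval p (\<lambda>v. a (\<rho> v))"
proof -
  have "eval (rename \<rho> p) a = (\<Sum>t\<in>Poly_Mapping.keys p. Poly_Mapping.lookup p t *
      (\<Prod>v\<in>Poly_Mapping.keys t. a (\<rho> v) ^ Poly_Mapping.lookup t v))"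
    by (simp add: rename_def subst_def eval_simps eval_prod)
  then show ?thesis by (simp add: eval_def subst_def)
qed

section \<open>The order induced by sums of squares\<close>

lemma sos_0 [simp]: "sum_of_squares 0"
  unfolding sum_of_squares_def by (rule exI [of _ "[]"]) simp

lemma sos_square: "sum_of_squares (p\<^sup>2)"
  unfolding sum_of_squares_def by (rule exI [of _ "[p]"]) simp

lemma sos_add: "sum_of_squares p \<Longrightarrow> sum_of_squares q \<Longrightarrow> sum_of_squares (p + q)"
  unfolding sum_of_squares_def by (metis map_append sum_list_append)

lemma sos_mult:
  assumes "sum_of_squares p" "sum_of_squares q"
  shows "sum_of_squares (p * q)"
proof -
  obtain ps where p: "p = (\<Sum>q\<leftarrow>ps. q\<^sup>2)" using assms by (auto simp: sum_of_squares_def)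
  obtain qs where q: "q = (\<Sum>q\<leftarrow>qs. q\<^sup>2)" using assms by (auto simp: sum_of_squares_def)
  have *: "sum_of_squares (a\<^sup>2 * (\<Sum>q\<leftarrow>qs. q\<^sup>2))" for a
    by (induction qs) (simp_all add: distrib_left sos_add sos_square flip: power_mult_distrib)
  have "sum_of_squares ((\<Sum>q\<leftarrow>ps. q\<^sup>2) * q)"
    by (induction ps) (use * q in \<open>simp_all add: distrib_right sos_add\<close>)
  then show ?thesis by (simp add: p)
qed

lemma sos_Const: "c \<ge> 0 \<Longrightarrow> sum_of_squares (Const c)"
  using sos_square [of "Const (sqrt c)"] by (simp flip: Const_power)

lemma sos_1 [simp]: "sum_of_squares 1"
  using sos_Const [of 1] by simp

lemma sos_sum: "(\<And>x. x \<in> A \<Longrightarrow> sum_of_squares (f x)) \<Longrightarrow> sum_of_squares (sum f A)"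
  by (induction A rule: infinite_finite_induct) (simp_all add: sos_add)

lemma sos_prod: "(\<And>x. x \<in> A \<Longrightarrow> sum_of_squares (f x)) \<Longrightarrow> sum_of_squares (prod f A)"
  by (induction A rule: infinite_finite_induct) (simp_all add: sos_mult)

lemma sos_power: "sum_of_squares p \<Longrightarrow> sum_of_squares (p ^ n)"
  by (induction n) (simp_all add: sos_mult)

lemma sos_even_power: "even n \<Longrightarrow> sum_of_squares (p ^ n)"
  by (metis evenE power_mult sos_power sos_square)

lemmas sos_intros = sos_add sos_mult sos_square sos_Const sos_sum sos_prod sos_power

lemma sos_eval_nonneg: "sum_of_squares p \<Longrightarrow> eval p a \<ge> 0"
proof -
  have "eval (\<Sum>q\<leftarrow>qs. q\<^sup>2) a \<ge> 0" for qs
    by (induction qs) (simp_all add: eval_simps)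
  then show "sum_of_squares p \<Longrightarrow> eval p a \<ge> 0" by (auto simp: sum_of_squares_def)
qed

definition sos_le :: "'v mpoly \<Rightarrow> 'v mpoly \<Rightarrow> bool" (infix "\<preceq>" 50) where
  "p \<preceq> q \<longleftrightarrow> sum_of_squares (q - p)"

lemma sos_le_0_iff: "0 \<preceq> p \<longleftrightarrow> sum_of_squares p"
  by (simp add: sos_le_def)

lemma sos_le_refl [simp]: "p \<preceq> p"
  by (simp add: sos_le_def)

lemma sos_le_trans [trans]: "p \<preceq> q \<Longrightarrow> q \<preceq> r \<Longrightarrow> p \<preceq> r"
  using sos_add [of "q - p" "r - q"] by (simp add: sos_le_def)

lemma sos_le_add: "p \<preceq> q \<Longrightarrow> p' \<preceq> q' \<Longrightarrow> p + p' \<preceq> q + q'"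
  using sos_add [of "q - p" "q' - p'"] by (simp add: sos_le_def algebra_simps)

lemma sos_le_sum: "(\<And>x. x \<in> A \<Longrightarrow> f x \<preceq> g x) \<Longrightarrow> sum f A \<preceq> sum g A"
  using sos_sum [of A "\<lambda>x. g x - f x"] by (simp add: sos_le_def sum_subtractf)

lemma sos_le_mult_left: "sum_of_squares r \<Longrightarrow> p \<preceq> q \<Longrightarrow> r * p \<preceq> r * q"
  using sos_mult [of r "q - p"] by (simp add: sos_le_def algebra_simps)

lemma sos_le_mult_right: "sum_of_squares r \<Longrightarrow> p \<preceq> q \<Longrightarrow> p * r \<preceq> q * r"
  using sos_le_mult_left [of r p q] by (simp add: mult.commute)

lemma sos_le_sos: "sum_of_squares p \<Longrightarrow> p \<preceq> q \<Longrightarrow> sum_of_squares q"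
  using sos_le_trans [of 0 p q] by (simp add: sos_le_0_iff)

lemma sos_le_mult:
  assumes "p \<preceq> q" "p' \<preceq> q'" "sum_of_squares p" "sum_of_squares p'"
  shows "p * p' \<preceq> q * q'"
  using sos_le_trans [of "p * p'" "p * q'" "q * q'"] sos_le_mult_left [of p p' q']
    sos_le_mult_right [of q' p q] assms sos_le_sos [of p' q'] by blast

lemma sos_le_power: "sum_of_squares p \<Longrightarrow> p \<preceq> q \<Longrightarrow> p ^ n \<preceq> q ^ n"
  by (induction n) (simp_all add: sos_le_mult sos_power)

lemma sos_le_Const_mult: "c \<le> d \<Longrightarrow> sum_of_squares p \<Longrightarrow> Const c * p \<preceq> Const d * p"
  using sos_mult [of "Const (d - c)" p] sos_Const [of "d - c"] by (simp add: sos_le_def Const_diff algebra_simps)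

lemma sos_le_sum_mono2:
  "finite B \<Longrightarrow> A \<subseteq> B \<Longrightarrow> (\<And>x. x \<in> B - A \<Longrightarrow> sum_of_squares (f x)) \<Longrightarrow> sum f A \<preceq> sum f B"
  using sum_diff [of B A f] sos_sum [of "B - A" f] by (simp add: sos_le_def)

lemma sos_le_sum_member:
  "finite A \<Longrightarrow> x \<in> A \<Longrightarrow> (\<And>x. x \<in> A \<Longrightarrow> sum_of_squares (f x)) \<Longrightarrow> f x \<preceq> sum f A"
  using sos_le_sum_mono2 [of A "{x}" f] by simp

section \<open>Truncated exponentials and power sums\<close>

definition trunc_exp :: "nat \<Rightarrow> 'v mpoly \<Rightarrow> 'v mpoly" where
  "trunc_exp T u = (\<Sum>k\<le>T. Const (1 / fact k) * u ^ k)"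

lemma sos_trunc_exp: "sum_of_squares u \<Longrightarrow> sum_of_squares (trunc_exp T u)"
  unfolding trunc_exp_def by (intro sos_intros) auto

lemma trunc_exp_mono:
  assumes "sum_of_squares u" "u \<preceq> v" "T \<le> S"
  shows "trunc_exp T u \<preceq> trunc_exp S v"
proof -
  have "trunc_exp T u \<preceq> trunc_exp T v"
    unfolding trunc_exp_def by (intro sos_le_sum sos_le_mult_left sos_le_power sos_Const) (use assms in auto)
  also have "trunc_exp T v \<preceq> trunc_exp S v"
    unfolding trunc_exp_def
    by (rule sos_le_sum_mono2) (use assms sos_le_sos [of u v] in \<open>auto intro!: sos_intros\<close>)
  finally show ?thesis .
qed

lemma trunc_exp_term: "sum_of_squares u \<Longrightarrow> k \<le> T \<Longrightarrow> Const (1 / fact k) * u ^ k \<preceq> trunc_exp T u"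
  unfolding trunc_exp_def by (rule sos_le_sum_member) (auto intro!: sos_intros)

text \<open>The product is a double sum over the rectangle \<open>{..T} \<times> {..S}\<close>.
  Enlarging it to the triangle \<open>i + j \<le> T + S\<close> only adds sums of squares, and by
  the binomial theorem the antidiagonals of the triangle are the terms of the exponential of
  \<open>u + v\<close>.\<close>

lemma trunc_exp_mult:
  assumes u: "sum_of_squares u" and v: "sum_of_squares v"
  shows "trunc_exp T u * trunc_exp S v \<preceq> trunc_exp (T + S) (u + v)"
proof -
  define F where "F i j = Const (1 / fact i) * u ^ i * (Const (1 / fact j) * v ^ j)" for i j
  have sosF: "sum_of_squares (F i j)" for i j
    unfolding F_def using assms by (intro sos_intros) auto
  have "trunc_exp T u * trunc_exp S v = (\<Sum>(i,j)\<in>{..T}\<times>{..S}. F i j)"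
    by (simp add: trunc_exp_def F_def sum_product sum.cartesian_product)
  also have "\<dots> \<preceq> (\<Sum>(i,j)\<in>{(i,j). i + j \<le> T + S}. F i j)"
  proof (rule sos_le_sum_mono2)
    show "finite {(i, j). i + j \<le> T + S}"
      by (rule finite_subset [of _ "{..T+S}\<times>{..T+S}"]) auto
  qed (use sosF in auto)
  also have "(\<Sum>(i,j)\<in>{(i,j). i + j \<le> T + S}. F i j) = (\<Sum>k\<le>T + S. \<Sum>i\<le>k. F i (k - i))"
    by (rule sum.triangle_reindex_eq)
  also have "\<dots> = trunc_exp (T + S) (u + v)"
    unfolding trunc_exp_def
  proof (rule sum.cong [OF refl])
    fix k
    have "F i (k - i) = Const (1 / fact k) * (of_nat (k choose i) * u ^ i * v ^ (k - i))" if "i \<le> k" for i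
    proof -
      have "Const (1 / fact i) * Const (1 / fact (k - i)) = Const (1 / fact k) * (of_nat (k choose i) :: 'a mpoly)"
        using that by (simp add: binomial_fact flip: Const_mult Const_of_nat)
      then show ?thesis
        unfolding F_def by (metis (no_types, lifting) mult.assoc mult.left_commute)
    qed
    then show "(\<Sum>i\<le>k. F i (k - i)) = Const (1 / fact k) * (u + v) ^ k"
      by (simp add: binomial_ring sum_distrib_left)
  qed
  finally show ?thesis .
qed

text \<open>As in Chebyshev's sum inequality, \<open>(u - v) * (u ^ k - v ^ k)\<close> has the
  factor \<open>(u - v)\<^sup>2\<close>; the other factor has only monomials in \<open>u\<close> and
  \<open>v\<close> with coefficient 1.\<close>

lemma chebyshev_sos:
  assumes "sum_of_squares u" "sum_of_squares v"
  shows "u * v ^ k \<preceq> u ^ Suc k + v ^ Suc k"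
proof -
  have "u ^ Suc k + v ^ Suc k - u * v ^ k = (u - v) * (u ^ k - v ^ k) + v * u ^ k"
    by (simp add: algebra_simps)
  also have "(u - v) * (u ^ k - v ^ k) = (u - v)\<^sup>2 * (\<Sum>i<k. v ^ (k - Suc i) * u ^ i)"
    by (simp add: power_diff_sumr2 power2_eq_square mult_ac)
  also have "sum_of_squares (\<dots> + v * u ^ k)"
    using assms by (intro sos_intros)
  finally show ?thesis by (simp add: sos_le_def)
qed

text \<open>A power mean inequality for \<preceq>. Each induction step applies
  \<open>chebyshev_sos\<close> to all pairs of indices and costs a factor \<open>2 * card I\<close>.
  This geometric loss is harmless, since it is absorbed later by choosing \<open>b\<close>
  small.\<close>

lemma power_sum_sos_le:
  fixes u :: "'i \<Rightarrow> 'v mpoly"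
  assumes u: "\<And>i. i \<in> I \<Longrightarrow> sum_of_squares (u i)" and I: "finite I" "I \<noteq> {}"
  shows "(\<Sum>i\<in>I. u i) ^ k \<preceq> Const ((2 * card I) ^ k) * (\<Sum>i\<in>I. u i ^ k)"
proof (induction k)
  case 0
  \<comment> \<open>For exponent 0 the claim says that 1 lies below the number of summands, so
    \<open>I\<close> must be nonempty.\<close>
  have "card I \<ge> 1" using I by (simp add: Suc_leI card_gt_0_iff)
  then have "Const 1 * 1 \<preceq> Const (card I) * (1 :: 'v mpoly)"
    by (intro sos_le_Const_mult) auto
  moreover have "(\<Sum>i\<in>I. 1 :: 'v mpoly) = Const (card I)"
    by (simp add: Const_def)
  ultimately show ?case by simp
next
  case (Suc k)
  have "(\<Sum>i\<in>I. u i) * (\<Sum>i\<in>I. u i ^ k) \<preceq> Const (2 * card I) * (\<Sum>i\<in>I. u i ^ Suc k)"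
  proof -
    have c: "(\<Sum>i\<in>I. c) = Const (card I) * c" for c :: "'v mpoly"
      by (simp add: Const_def)
    have "(\<Sum>i\<in>I. u i) * (\<Sum>i\<in>I. u i ^ k) = (\<Sum>i\<in>I. \<Sum>j\<in>I. u i * u j ^ k)"
      by (simp add: sum_product)
    also have "\<dots> \<preceq> (\<Sum>i\<in>I. \<Sum>j\<in>I. u i ^ Suc k + u j ^ Suc k)"
      by (intro sos_le_sum chebyshev_sos u)
    also have "\<dots> = Const (2 * card I) * (\<Sum>i\<in>I. u i ^ Suc k)"
      by (simp add: sum.distrib c Const_mult Const_add sum_distrib_left algebra_simps Const_of_nat Const_numeral)
    finally show ?thesis .
  qed
  then have "Const ((2 * card I) ^ k) * ((\<Sum>i\<in>I. u i) * (\<Sum>i\<in>I. u i ^ k)) \<preceq>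
      Const ((2 * card I) ^ k) * (Const (2 * card I) * (\<Sum>i\<in>I. u i ^ Suc k))"
    by (intro sos_le_mult_left sos_Const) auto
  moreover have "(\<Sum>i\<in>I. u i) * (\<Sum>i\<in>I. u i) ^ k \<preceq>
      (\<Sum>i\<in>I. u i) * (Const ((2 * card I) ^ k) * (\<Sum>i\<in>I. u i ^ k))"
    by (intro sos_le_mult_left Suc.IH sos_sum u)
  ultimately show ?case
    by (auto intro: sos_le_trans simp: Const_mult mult_ac)
qed

section \<open>Convergence dominated by Gaussian-type majorants\<close>

definition sum_Var_sq :: "'v::finite mpoly" where
  "sum_Var_sq = (\<Sum>i\<in>UNIV. (Var i)\<^sup>2)"

lemma sos_sum_Var_sq: "sum_of_squares sum_Var_sq"
  unfolding sum_Var_sq_def by (intro sos_intros)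

definition majorant :: "real \<Rightarrow> nat \<Rightarrow> 'v::finite mpoly" where
  "majorant b T = trunc_exp T (Const b * sum_Var_sq)"

lemma sos_majorant: "b \<ge> 0 \<Longrightarrow> sum_of_squares (majorant b T)"
  unfolding majorant_def by (intro sos_trunc_exp sos_intros sos_sum_Var_sq)

lemma majorant_mono: "0 \<le> b \<Longrightarrow> b \<le> b' \<Longrightarrow> T \<le> T' \<Longrightarrow> majorant b T \<preceq> majorant b' T'"
  unfolding majorant_def
  by (intro trunc_exp_mono sos_le_Const_mult sos_mult sos_Const sos_sum_Var_sq)

lemma majorant_mult:
  "b \<ge> 0 \<Longrightarrow> b' \<ge> 0 \<Longrightarrow> majorant b T * majorant b' T' \<preceq> majorant (b + b') (T + T')"
  unfolding majorant_def Const_add distrib_right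
  by (intro trunc_exp_mult sos_mult sos_Const sos_sum_Var_sq)

lemma one_le_majorant: "b \<ge> 0 \<Longrightarrow> 1 \<preceq> majorant b T"
  using trunc_exp_term [of "Const b * sum_Var_sq" 0 T]
  by (simp add: majorant_def sos_mult sos_Const sos_sum_Var_sq)

text \<open>An absolute value bound by \<delta> times a truncation of exp (b |x|^2). The order
  \<open>T\<close> is left existential because raising it only enlarges the majorant;
  \<open>b\<close> and \<delta> are the quantities to be tracked.\<close>

definition small :: "real \<Rightarrow> real \<Rightarrow> 'v::finite mpoly \<Rightarrow> bool" where
  "small b \<delta> p \<longleftrightarrow> (\<exists>T. p \<preceq> Const \<delta> * majorant b T \<and> - p \<preceq> Const \<delta> * majorant b T)"

lemma smallI: "p \<preceq> Const \<delta> * majorant b T \<Longrightarrow> - p \<preceq> Const \<delta> * majorant b T \<Longrightarrow> small b \<delta> p"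
  by (auto simp: small_def)

lemma small_mono:
  assumes "small b \<delta> p" "0 \<le> \<delta>" "\<delta> \<le> \<delta>'" "0 \<le> b" "b \<le> b'"
  shows "small b' \<delta>' p"
proof -
  obtain T where T: "p \<preceq> Const \<delta> * majorant b T" "- p \<preceq> Const \<delta> * majorant b T"
    using assms by (auto simp: small_def)
  have "Const \<delta> * majorant b T \<preceq> Const \<delta>' * majorant b' T"
    using assms by (intro sos_le_mult sos_Const sos_majorant majorant_mono)
      (auto simp: sos_le_def sos_Const simp flip: Const_diff)
  then show ?thesis using T by (auto simp: small_def intro: sos_le_trans)
qed

lemma small_uminus_iff [simp]: "small b \<delta> (- p) \<longleftrightarrow> small b \<delta> p"
  by (auto simp: small_def)

lemma small_add:
  assumes "small b \<delta> p" "small b \<delta>' p'" "0 \<le> \<delta>" "0 \<le> \<delta>'" "0 \<le> b"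
  shows "small b (\<delta> + \<delta>') (p + p')"
proof -
  obtain T where T: "p \<preceq> Const \<delta> * majorant b T" "- p \<preceq> Const \<delta> * majorant b T"
    using assms by (auto simp: small_def)
  obtain S where S: "p' \<preceq> Const \<delta>' * majorant b S" "- p' \<preceq> Const \<delta>' * majorant b S"
    using assms by (auto simp: small_def)
  have m: "Const \<delta> * majorant b T \<preceq> Const \<delta> * majorant b (max T S)"
      "Const \<delta>' * majorant b S \<preceq> Const \<delta>' * majorant b (max T S)"
    using assms by (intro sos_le_mult_left sos_Const majorant_mono; simp)+
  show ?thesis
  proof (rule smallI)
    show "p + p' \<preceq> Const (\<delta> + \<delta>') * majorant b (max T S)"
      unfolding Const_add distrib_right
      by (intro sos_le_add sos_le_trans [OF T(1) m(1)] sos_le_trans [OF S(1) m(2)])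
    show "- (p + p') \<preceq> Const (\<delta> + \<delta>') * majorant b (max T S)"
      unfolding Const_add distrib_right minus_add_distrib
      by (intro sos_le_add sos_le_trans [OF T(2) m(1)] sos_le_trans [OF S(2) m(2)])
  qed
qed

text \<open>The difference \<open>a * b - p * q\<close> is the average of
  \<open>(a - p) * (b + q)\<close> and \<open>(a + p) * (b - q)\<close>, whose factors are sums of
  squares by the four hypotheses.\<close>

lemma sos_le_mult_abs:
  assumes "p \<preceq> a" "- p \<preceq> a" "q \<preceq> b" "- q \<preceq> b"
  shows "p * q \<preceq> a * b"
proof -
  have "a * b - p * q = Const (1/2) * ((a - p) * (b - - q) + (a - - p) * (b - q))"
  proof -
    have "Const (1/2) * (2 * x) = x" for x :: "'a mpoly"
      unfolding Const_numeral [symmetric] mult.assoc [symmetric] Const_mult [symmetric] by simp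
    from this [of "a * b - p * q"] show ?thesis by (simp add: algebra_simps)
  qed
  then show ?thesis
    using assms unfolding sos_le_def by (auto intro!: sos_intros)
qed

lemma small_mult:
  assumes "small b \<delta> p" "small b' \<delta>' p'" "0 \<le> \<delta>" "0 \<le> \<delta>'" "0 \<le> b" "0 \<le> b'"
  shows "small (b + b') (\<delta> * \<delta>') (p * p')"
proof -
  obtain T where T: "p \<preceq> Const \<delta> * majorant b T" "- p \<preceq> Const \<delta> * majorant b T"
    using assms by (auto simp: small_def)
  obtain S where S: "p' \<preceq> Const \<delta>' * majorant b' S" "- p' \<preceq> Const \<delta>' * majorant b' S"
    using assms by (auto simp: small_def)
  have "Const \<delta> * majorant b T * (Const \<delta>' * majorant b' S) =
      Const (\<delta> * \<delta>') * (majorant b T * majorant b' S)"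
    by (simp add: Const_mult mult_ac)
  also have "\<dots> \<preceq> Const (\<delta> * \<delta>') * majorant (b + b') (T + S)"
    using assms by (intro sos_le_mult_left sos_Const majorant_mult) auto
  finally have m: "Const \<delta> * majorant b T * (Const \<delta>' * majorant b' S) \<preceq>
      Const (\<delta> * \<delta>') * majorant (b + b') (T + S)" .
  have "- (p * p') = (- p) * p'" by simp
  then show ?thesis
    using sos_le_mult_abs [OF T S] sos_le_mult_abs [of "- p", OF T(2) _ S] T(1)
    by (intro smallI) (auto intro: sos_le_trans [OF _ m])
qed

lemma small_Const:
  assumes "\<bar>c\<bar> \<le> \<delta>" "0 \<le> b"
  shows "small b \<delta> (Const c)"
proof -
  have *: "Const x \<preceq> Const \<delta> * majorant b 0" if "x \<le> \<delta>" for x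
  proof -
    have "Const x \<preceq> Const \<delta> * 1" using sos_le_Const_mult [of x \<delta> 1] that by simp
    also have "\<dots> \<preceq> Const \<delta> * majorant b 0"
      using assms by (intro sos_le_mult_left sos_Const one_le_majorant) auto
    finally show ?thesis .
  qed
  show ?thesis
    using * [of c] * [of "- c"] assms by (intro smallI [of _ _ _ 0]) (auto simp: Const_uminus abs_le_iff)
qed

lemma theta_mono: "r \<le> s \<Longrightarrow> \<theta> r \<preceq> \<theta> s"
  unfolding \<theta>_def by (rule sos_le_sum_mono2) (auto intro!: sos_intros sos_even_power)

text \<open>The comparison is made degree by degree: \<open>power_sum_sos_le\<close> for the squares
  of the variables separates them at the cost of \<open>(2 * CARD('v)) ^ k\<close>, and the bound on
  \<open>b\<close> compensates this factor.\<close>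

lemma majorant_le_theta:
  assumes "0 \<le> b" "2 * real CARD('v::finite) * b \<le> 1"
  shows "majorant b T \<preceq> (\<theta> T :: 'v mpoly)"
proof -
  have "Const (1 / fact k) * (Const b * sum_Var_sq) ^ k \<preceq>
      Const (1 / fact k) * (\<Sum>i\<in>UNIV. Var i ^ (2 * k) :: 'v mpoly)" for k
  proof (intro sos_le_mult_left sos_Const)
    have "sum_Var_sq ^ k \<preceq> Const ((2 * CARD('v)) ^ k) * (\<Sum>i\<in>UNIV. Var i ^ (2 * k) :: 'v mpoly)"
      using power_sum_sos_le [of UNIV "\<lambda>i :: 'v. (Var i)\<^sup>2" k]
      by (simp add: sum_Var_sq_def sos_square power_mult)
    then have "Const (b ^ k) * sum_Var_sq ^ k \<preceq>
        Const (b ^ k) * (Const ((2 * CARD('v)) ^ k) * (\<Sum>i\<in>UNIV. Var i ^ (2 * k) :: 'v mpoly))"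
      using assms by (intro sos_le_mult_left sos_Const) auto
    also have "\<dots> = Const ((2 * real CARD('v) * b) ^ k) * (\<Sum>i\<in>UNIV. Var i ^ (2 * k) :: 'v mpoly)"
      by (simp add: Const_mult power_mult_distrib mult_ac)
    also have "\<dots> \<preceq> Const 1 * (\<Sum>i\<in>UNIV. Var i ^ (2 * k) :: 'v mpoly)"
      using assms by (intro sos_le_Const_mult power_le_one sos_sum sos_even_power) auto
    finally show "(Const b * sum_Var_sq) ^ k \<preceq> (\<Sum>i\<in>UNIV. Var i ^ (2 * k) :: 'v mpoly)"
      by (simp add: power_mult_distrib Const_power)
  qed simp
  then show ?thesis
    unfolding majorant_def trunc_exp_def \<theta>_def by (simp add: sum_distrib_left [symmetric] sos_le_sum)
qed

text \<open>The way back from \<open>small\<close> to sums of squares: \<open>- p\<close> lies below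
  \<delta> times a majorant of some order \<open>T\<close>, hence below \<delta> times \<theta> of
  every order from \<open>T\<close> on.\<close>

lemma small_imp_sos:
  fixes p :: "'v::finite mpoly"
  assumes "small b \<delta> p" "0 \<le> \<delta>" "0 \<le> b" "2 * real CARD('v) * b \<le> 1"
  obtains r where "\<And>s. r \<le> s \<Longrightarrow> sum_of_squares (p + Const \<delta> * \<theta> s)"
proof -
  obtain T where T: "- p \<preceq> Const \<delta> * majorant b T"
    using assms by (auto simp: small_def)
  show thesis
  proof
    fix s assume "T \<le> s"
    have "majorant b T \<preceq> (\<theta> s :: 'v mpoly)"
      using majorant_le_theta [of b T, where 'v = 'v] theta_mono [OF \<open>T \<le> s\<close>] assms by (blast intro: sos_le_trans)
    then have "- p \<preceq> Const \<delta> * \<theta> s"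
      using T assms by (blast intro: sos_le_trans sos_le_mult_left sos_Const)
    then show "sum_of_squares (p + Const \<delta> * \<theta> s)"
      by (simp add: sos_le_def add.commute)
  qed
qed

section \<open>A calculus of bounded, null and asymptotically equal families of polynomials\<close>

definition bdd :: "'i filter \<Rightarrow> ('i \<Rightarrow> 'v::finite mpoly) \<Rightarrow> bool" where
  "bdd F P \<longleftrightarrow> (\<forall>b>0. \<exists>A\<ge>0. \<forall>\<^sub>F n in F. small b A (P n))"

text \<open>Like boundedness, this is demanded for every \<open>b > 0\<close>: multiplication adds
  the parameters \<open>b\<close>, so a product is estimated by spending \<open>b/2\<close> on each
  factor.\<close>

definition null :: "'i filter \<Rightarrow> ('i \<Rightarrow> 'v::finite mpoly) \<Rightarrow> bool" where
  "null F P \<longleftrightarrow> (\<forall>b>0. \<forall>\<delta>>0. \<forall>\<^sub>F n in F. small b \<delta> (P n))"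

text \<open>Boundedness of both families is included so that products can be compared through P P' -
  Q Q' = (P - Q) P' + (P' - Q') Q.\<close>

definition conv :: "'i filter \<Rightarrow> ('i \<Rightarrow> 'v::finite mpoly) \<Rightarrow> ('i \<Rightarrow> 'v mpoly) \<Rightarrow> bool" where
  "conv F P Q \<longleftrightarrow> bdd F P \<and> bdd F Q \<and> null F (\<lambda>n. P n - Q n)"

lemma bddI:
  assumes "\<And>b. b > 0 \<Longrightarrow> \<exists>A\<ge>0. \<forall>\<^sub>F n in F. small b A (P n)"
  shows "bdd F P"
  using assms by (auto simp: bdd_def)

lemma null_imp_bdd: "null F P \<Longrightarrow> bdd F P"
  unfolding null_def by (rule bddI, rule exI [of _ 1]) simp

lemma bdd_add:
  assumes "bdd F P" "bdd F Q"
  shows "bdd F (\<lambda>n. P n + Q n)"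
proof (rule bddI)
  fix b :: real assume b: "b > 0"
  obtain A B where AB: "A \<ge> 0" "B \<ge> 0"
    and ev: "\<forall>\<^sub>F n in F. small b A (P n)" "\<forall>\<^sub>F n in F. small b B (Q n)"
    using assms b unfolding bdd_def by meson
  have "\<forall>\<^sub>F n in F. small b (A + B) (P n + Q n)"
    using ev by eventually_elim (use b AB small_add [of b A _ B] in auto)
  then show "\<exists>A\<ge>0. \<forall>\<^sub>F n in F. small b A (P n + Q n)"
    using AB by (intro exI [of _ "A + B"]) auto
qed

lemma null_add:
  assumes "null F P" "null F Q"
  shows "null F (\<lambda>n. P n + Q n)"
  unfolding null_def
proof (intro allI impI)
  fix b \<delta> :: real assume b: "b > 0" "\<delta> > 0"
  have "\<forall>\<^sub>F n in F. small b (\<delta>/2) (P n)" "\<forall>\<^sub>F n in F. small b (\<delta>/2) (Q n)"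
    using assms b unfolding null_def by auto
  then show "\<forall>\<^sub>F n in F. small b \<delta> (P n + Q n)"
    by eventually_elim (use b small_add [of b "\<delta>/2" _ "\<delta>/2"] in auto)
qed

lemma bdd_mult:
  assumes "bdd F P" "bdd F Q"
  shows "bdd F (\<lambda>n. P n * Q n)"
proof (rule bddI)
  fix b :: real assume b: "b > 0"
  obtain A B where AB: "A \<ge> 0" "B \<ge> 0" and
    ev: "\<forall>\<^sub>F n in F. small (b/2) A (P n)" "\<forall>\<^sub>F n in F. small (b/2) B (Q n)"
    using assms b unfolding bdd_def by (meson half_gt_zero)
  have "\<forall>\<^sub>F n in F. small b (A * B) (P n * Q n)"
    using ev by eventually_elim (use b AB small_mult [of "b/2" A _ "b/2" B] in auto)
  then show "\<exists>A\<ge>0. \<forall>\<^sub>F n in F. small b A (P n * Q n)"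
    using AB by (intro exI [of _ "A * B"]) auto
qed

lemma null_mult:
  assumes "null F P" "bdd F Q"
  shows "null F (\<lambda>n. P n * Q n)"
  unfolding null_def
proof (intro allI impI)
  fix b \<delta> :: real assume b: "b > 0" "\<delta> > 0"
  obtain A where A: "A \<ge> 0" and ev: "\<forall>\<^sub>F n in F. small (b/2) A (Q n)"
    using assms b unfolding bdd_def by (meson half_gt_zero)
  \<comment> \<open>The denominator \<open>A + 1\<close> is positive even if \<open>A\<close> is 0,
    and \<open>\<delta> / (A + 1) * A \<le> \<delta>\<close>.\<close>
  have "\<forall>\<^sub>F n in F. small (b/2) (\<delta> / (A + 1)) (P n)"
    using assms b A unfolding null_def by simp
  with ev show "\<forall>\<^sub>F n in F. small b \<delta> (P n * Q n)"
  proof eventually_elim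
    case (elim n)
    then have "small (b/2 + b/2) (\<delta> / (A + 1) * A) (P n * Q n)"
      using A b by (intro small_mult) auto
    then show ?case
      by (rule small_mono) (use A b in \<open>auto simp: field_simps\<close>)
  qed
qed

lemma bdd_Const: "bdd F (\<lambda>_. Const c)"
proof (rule bddI)
  fix b :: real assume "b > 0"
  then show "\<exists>A\<ge>0. \<forall>\<^sub>F n in F. small b A (Const c)"
    by (intro exI [of _ "\<bar>c\<bar>"]) (simp add: small_Const)
qed

lemma null_Const:
  assumes "(c \<longlongrightarrow> 0) F"
  shows "null F (\<lambda>n. Const (c n))"
  unfolding null_def
proof (intro allI impI)
  fix b \<delta> :: real assume b: "b > 0" "\<delta> > 0"
  have "\<forall>\<^sub>F n in F. \<bar>c n\<bar> < \<delta>"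
    using tendstoD [OF assms b(2)] by (simp add: dist_real_def)
  then show "\<forall>\<^sub>F n in F. small b \<delta> (Const (c n))"
    by eventually_elim (use b in \<open>auto intro: small_Const\<close>)
qed

lemma bdd_0: "bdd F (\<lambda>_. 0)" and bdd_1: "bdd F (\<lambda>_. 1)"
  using bdd_Const [of F 0] bdd_Const [of F 1] by simp_all

lemma null_0: "null F (\<lambda>_. 0)"
  using null_Const [of "\<lambda>_. 0" F] by simp

lemma convI: "bdd F Q \<Longrightarrow> null F (\<lambda>n. P n - Q n) \<Longrightarrow> conv F P Q"
  using bdd_add [of F "\<lambda>n. P n - Q n" Q] by (simp add: conv_def null_imp_bdd)

lemma conv_refl: "bdd F P \<Longrightarrow> conv F P P"
  by (simp add: conv_def null_0)

lemma conv_trans [trans]: "conv F P Q \<Longrightarrow> conv F Q R \<Longrightarrow> conv F P R"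
  using null_add [of F "\<lambda>n. P n - Q n" "\<lambda>n. Q n - R n"] by (simp add: conv_def)

lemma conv_add: "conv F P Q \<Longrightarrow> conv F P' Q' \<Longrightarrow> conv F (\<lambda>n. P n + P' n) (\<lambda>n. Q n + Q' n)"
  using null_add [of F "\<lambda>n. P n - Q n" "\<lambda>n. P' n - Q' n"]
  by (simp add: conv_def bdd_add algebra_simps)

lemma conv_mult:
  assumes "conv F P Q" "conv F P' Q'"
  shows "conv F (\<lambda>n. P n * P' n) (\<lambda>n. Q n * Q' n)"
proof -
  have "null F (\<lambda>n. (P n - Q n) * P' n + (P' n - Q' n) * Q n)"
    using assms by (intro null_add null_mult) (auto simp: conv_def)
  then show ?thesis
    using assms by (simp add: conv_def bdd_mult algebra_simps)
qed

lemma conv_Const: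
  assumes "(c \<longlongrightarrow> a) F"
  shows "conv F (\<lambda>n. Const (c n)) (\<lambda>_. Const a)"
  using null_Const [of "\<lambda>n. c n - a" F] tendsto_diff [OF assms tendsto_const [of a]]
  by (intro convI bdd_Const) (simp add: Const_diff)

lemma conv_sum:
  assumes "\<And>x. x \<in> A \<Longrightarrow> conv F (\<lambda>n. P n x) (\<lambda>n. Q n x)"
  shows "conv F (\<lambda>n. \<Sum>x\<in>A. P n x) (\<lambda>n. \<Sum>x\<in>A. Q n x)"
  using assms
  by (induction A rule: infinite_finite_induct) (simp_all add: conv_refl bdd_0 conv_add)

lemma conv_prod:
  assumes "\<And>x. x \<in> A \<Longrightarrow> conv F (\<lambda>n. P n x) (\<lambda>n. Q n x)"
  shows "conv F (\<lambda>n. \<Prod>x\<in>A. P n x) (\<lambda>n. \<Prod>x\<in>A. Q n x)"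
  using assms
  by (induction A rule: infinite_finite_induct) (simp_all add: conv_refl bdd_1 conv_mult)

lemma conv_power: "conv F P Q \<Longrightarrow> conv F (\<lambda>n. P n ^ k) (\<lambda>n. Q n ^ k)"
  by (induction k) (simp_all add: conv_refl bdd_1 conv_mult)

lemma conv_subst:
  assumes "\<And>v. conv F (\<lambda>n. s n v) (\<lambda>n. s' n v)"
  shows "conv F (\<lambda>n. subst Const (s n) p) (\<lambda>n. subst Const (s' n) p)"
  unfolding subst_def
  by (intro conv_sum conv_mult conv_prod conv_power assms conv_refl bdd_Const)

lemma conv_cong_eventually:
  assumes "conv F P Q" "\<forall>\<^sub>F n in F. P n = P' n"
  shows "conv F P' Q"
proof -
  have ev: "eventually (\<lambda>n. \<Phi> (P' n) n) F" if "eventually (\<lambda>n. \<Phi> (P n) n) F" for \<Phi>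
    using that assms(2) by eventually_elim auto
  have "null F (\<lambda>n. P' n - Q n)"
    using assms ev [of "\<lambda>p n. small _ _ (p - Q n)"] by (auto simp: conv_def null_def)
  then show ?thesis
    using assms(1) by (intro convI) (auto simp: conv_def)
qed

section \<open>Domination of power series of exponential type\<close>

lemma sum_half_power_le: "(\<Sum>k\<le>n. (1/2 :: real) ^ k) \<le> 2"
  by (simp add: sum_gp0)

text \<open>Here \<open>2 * j\<close> is an even exponent next to \<open>k\<close>, so
  \<open>q = k - j\<close> is about \<open>k / 2\<close>. Then \<open>fact j / fact k\<close> is at
  most \<open>1 / fact q\<close>, while all other factors grow only geometrically in
  \<open>q\<close>. The factor \<open>(1/2) ^ k\<close> on the right makes the bounds summable over
  \<open>k\<close>.\<close>

lemma power_fact_bounded: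
  fixes B b :: real
  assumes "B \<ge> 0" "b > 0"
  obtains A where "A \<ge> 0"
    and "\<And>k j. j = k div 2 \<or> j = Suc k div 2 \<Longrightarrow> B ^ k / fact k * (fact j / b ^ j) \<le> A * (1/2) ^ k"
proof -
  \<comment> \<open>Bases of at least 1 allow the exponents to be raised to functions of
    \<open>q\<close>. The 2 in \<open>2 * B\<close> pays for the factor
    \<open>(1/2) ^ k\<close>.\<close>
  define D where "D = max 1 (2 * B)"
  define e where "e = max 1 (1 / b)"
  have De: "1 \<le> D" "1 \<le> e" "2 * B \<le> D" "1 / b \<le> e" by (auto simp: D_def e_def)
  have "Bseq (\<lambda>q. inverse (fact q) * (D\<^sup>2 * e) ^ q)"
    by (rule convergent_imp_Bseq [OF convergentI]) (rule summable_LIMSEQ_zero [OF summable_exp])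
  then obtain M where M: "\<And>q. \<bar>inverse (fact q) * (D\<^sup>2 * e) ^ q\<bar> \<le> M"
    by (auto simp: Bseq_def)
  have M0: "0 \<le> M" using M [of 0] by simp
  show thesis
  proof
    show "0 \<le> D * e * M" using De M0 by simp
    fix k j :: nat assume j: "j = k div 2 \<or> j = Suc k div 2"
    define q where "q = k - j"
    \<comment> \<open>The slack of 1 in both bounds is attained when \<open>k\<close> is odd and
      \<open>j\<close> is rounded up.\<close>
    have kj: "k = j + q" "k \<le> 2 * q + 1" "j \<le> q + 1" using j by (auto simp: q_def)
    have "(2 * B) ^ k \<le> D ^ k" using assms De by (intro power_mono) auto
    also have "D ^ k \<le> D ^ (2 * q + 1)" using De kj by (intro power_increasing) auto
    finally have 1: "(2 * B) ^ k \<le> D ^ (2 * q + 1)" .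
    have "(1 / b) ^ j \<le> e ^ j" using assms De by (intro power_mono) auto
    also have "e ^ j \<le> e ^ (q + 1)" using De kj by (intro power_increasing) auto
    finally have 2: "(1 / b) ^ j \<le> e ^ (q + 1)" .
    have "fact j * fact q \<le> (fact k :: nat)"
      using fact_fact_dvd_fact [of j q] kj by (intro dvd_imp_le) auto
    then have "fact j * fact q \<le> (fact k :: real)"
      by (metis of_nat_fact of_nat_le_iff of_nat_mult)
    then have 3: "fact j / fact k \<le> inverse (fact q :: real)"
      by (simp add: field_simps)
    have "(2 * B) ^ k / fact k * (fact j / b ^ j) = (2 * B) ^ k * (1 / b) ^ j * (fact j / fact k)"
      by (simp add: power_divide)
    also have "\<dots> \<le> (D ^ (2 * q + 1) * e ^ (q + 1)) * inverse (fact q)"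
      using assms De by (intro mult_mono 1 2 3) auto
    also have "\<dots> = D * e * (inverse (fact q) * (D\<^sup>2 * e) ^ q)"
      by (simp add: power_mult_distrib power_mult [symmetric] power_add)
    also have "\<dots> \<le> D * e * M"
      using De M [of q] by (intro mult_left_mono) auto
    finally show "B ^ k / fact k * (fact j / b ^ j) \<le> D * e * M * (1/2) ^ k"
      by (simp add: power_mult_distrib field_simps)
  qed
qed

text \<open>The power is, up to the scalar \<open>fact j / b ^ j\<close>, the term of degree
  \<open>j\<close> in the truncated exponential of \<open>b\<close> times the square of one
  variable.\<close>

lemma even_power_le_majorant:
  fixes i :: "'v::finite"
  assumes "b > 0" "j \<le> T"
  shows "Var i ^ (2 * j) \<preceq> Const (fact j / b ^ j) * majorant b T"
proof -
  have "(Var i)\<^sup>2 \<preceq> sum_Var_sq"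
    unfolding sum_Var_sq_def by (rule sos_le_sum_member) (auto simp: sos_square)
  then have v: "Const b * (Var i)\<^sup>2 \<preceq> Const b * sum_Var_sq"
    using assms by (intro sos_le_mult_left sos_Const) auto
  have sos: "sum_of_squares (Const b * (Var i)\<^sup>2)"
    using assms by (intro sos_intros) auto
  have "Const (1 / fact j) * (Const b * (Var i)\<^sup>2) ^ j \<preceq> majorant b T"
    unfolding majorant_def
    using trunc_exp_term [OF sos assms(2)] trunc_exp_mono [OF sos v order.refl] by (rule sos_le_trans)
  then have "Const (fact j / b ^ j) * (Const (1 / fact j) * (Const b * (Var i)\<^sup>2) ^ j) \<preceq>
      Const (fact j / b ^ j) * majorant b T"
    using assms by (intro sos_le_mult_left sos_Const) auto
  moreover have "Const (fact j / b ^ j) * (Const (1 / fact j) * (Const b * (Var i)\<^sup>2) ^ j) =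
      Const (fact j / b ^ j * (1 / fact j) * b ^ j) * Var i ^ (2 * j)"
    by (simp only: Const_mult Const_power power_mult_distrib power_mult [symmetric] mult_ac)
  ultimately show ?thesis using assms by simp
qed

text \<open>Here \<open>s\<close> plays the role of a sign, so that \<plusminus>x^k is bounded by
  the neighbouring even powers. For odd k = 2 l + 1 this is the square of x^l - s x^(l+1); for even
  \<open>k\<close> both powers on the right are x^k, and (1 - s)^2 = 2 (1 - s).\<close>

lemma power_le_even_powers: "s\<^sup>2 = 1 \<Longrightarrow> s * x ^ k \<preceq> x ^ (2 * (k div 2)) + x ^ (2 * (Suc k div 2))"
proof (cases "even k")
  case True
  assume s: "s\<^sup>2 = 1"
  then obtain l where k: "k = 2 * l" using True by auto
  have "x ^ k + x ^ k - s * x ^ k = Const (1/2) * (x ^ l * (1 - s))\<^sup>2 + x ^ k"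
  proof -
    have "(x ^ l * (1 - s))\<^sup>2 = x ^ k * (1 + s\<^sup>2 - 2 * s)"
      by (simp add: k power_mult power_mult_distrib power2_eq_square algebra_simps)
    also have "\<dots> = 2 * (x ^ k * (1 - s))"
      unfolding s by (simp add: algebra_simps)
    also have "Const (1/2) * \<dots> = x ^ k * (1 - s)"
      by (rule Const_half_mult_2)
    finally show ?thesis by (simp add: algebra_simps)
  qed
  moreover have "sum_of_squares \<dots>"
    using True by (intro sos_intros sos_even_power) auto
  ultimately have "sum_of_squares (x ^ k + x ^ k - s * x ^ k)" by (simp only:)
  then show ?thesis using True by (simp add: sos_le_def)
next
  case False
  assume s: "s\<^sup>2 = 1"
  then obtain l where k: "k = Suc (2 * l)" using False by (metis oddE Suc_eq_plus1)
  have "x ^ (2 * l) + x ^ (2 * Suc l) - s * x ^ k =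
      Const (1/2) * ((x ^ l - s * x ^ Suc l)\<^sup>2 + (x ^ l)\<^sup>2 + (x ^ Suc l)\<^sup>2)"
  proof -
    have "(x ^ l - s * x ^ Suc l)\<^sup>2 = (x ^ l)\<^sup>2 + s\<^sup>2 * (x ^ Suc l)\<^sup>2 - 2 * s * (x ^ l * x ^ Suc l)"
      by (simp add: power2_eq_square algebra_simps)
    then have "(x ^ l - s * x ^ Suc l)\<^sup>2 + (x ^ l)\<^sup>2 + (x ^ Suc l)\<^sup>2 =
        2 * (x ^ (2 * l) + x ^ (2 * Suc l) - s * x ^ k)"
      unfolding s k by (simp add: power_mult power_mult_distrib power2_eq_square algebra_simps)
    then show ?thesis by (simp only: Const_half_mult_2)
  qed
  moreover have "sum_of_squares \<dots>"
    by (intro sos_intros) auto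
  ultimately show ?thesis using k by (simp add: sos_le_def)
qed

text \<open>Exponential type (order 1) is dominated by every order 2 majorant, however small \<open>b\<close> is.\<close>

lemma small_power_series:
  fixes B b :: real
  assumes "B \<ge> 0" "b > 0"
  obtains A where "A \<ge> 0"
    and "\<And>\<delta> c n (i :: 'v::finite). \<delta> \<ge> 0 \<Longrightarrow> (\<And>k. k \<le> n \<Longrightarrow> \<bar>c k\<bar> \<le> \<delta> * B ^ k / fact k) \<Longrightarrow>
      small b (\<delta> * A) (\<Sum>k\<le>n. Const (c k) * Var i ^ k)"
proof -
  obtain A where A: "A \<ge> 0"
    "\<And>k j. j = k div 2 \<or> j = Suc k div 2 \<Longrightarrow> B ^ k / fact k * (fact j / b ^ j) \<le> A * (1/2) ^ k"
    using power_fact_bounded [OF assms] by blast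
  \<comment> \<open>The constant 4 is made of a factor 2 for the two even powers that bound each
    term and a factor 2 for the geometric series. The bound on the negative comes from applying this
    to \<open>- c\<close>.\<close>
  have *: "(\<Sum>k\<le>n. Const (c k) * Var i ^ k) \<preceq> Const (\<delta> * (4 * A)) * majorant b n"
    if \<delta>: "\<delta> \<ge> 0" and c: "\<And>k. k \<le> n \<Longrightarrow> \<bar>c k\<bar> \<le> \<delta> * B ^ k / fact k" for \<delta> c n and i :: 'v
  proof -
    have summand: "Const (c k) * Var i ^ k \<preceq> Const (2 * \<delta> * A * (1/2) ^ k) * majorant b n" if k: "k \<le> n" for k
    proof -
      have half: "Const \<bar>c k\<bar> * Var i ^ (2 * j) \<preceq> Const (\<delta> * A * (1/2) ^ k) * majorant b n"
        if j: "j = k div 2 \<or> j = Suc k div 2" for j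
      proof -
        have "j \<le> n" using j k by auto
        have "Const \<bar>c k\<bar> * Var i ^ (2 * j) \<preceq> Const \<bar>c k\<bar> * (Const (fact j / b ^ j) * majorant b n)"
          by (intro sos_le_mult_left sos_Const even_power_le_majorant) (use assms \<open>j \<le> n\<close> in auto)
        also have "\<dots> = Const (\<bar>c k\<bar> * (fact j / b ^ j)) * majorant b n"
          by (simp only: Const_mult mult.assoc)
        also have "\<dots> \<preceq> Const (\<delta> * A * (1/2) ^ k) * majorant b n"
        proof (rule sos_le_Const_mult)
          have "\<bar>c k\<bar> * (fact j / b ^ j) \<le> \<delta> * B ^ k / fact k * (fact j / b ^ j)"
            using c [OF k] assms by (intro mult_right_mono) auto
          also have "\<dots> = \<delta> * (B ^ k / fact k * (fact j / b ^ j))" by simp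
          also have "\<dots> \<le> \<delta> * (A * (1/2) ^ k)" using A(2) [OF j] \<delta> by (intro mult_left_mono)
          finally show "\<bar>c k\<bar> * (fact j / b ^ j) \<le> \<delta> * A * (1/2) ^ k" by simp
        qed (use assms in \<open>auto intro: sos_majorant\<close>)
        finally show ?thesis .
      qed
      \<comment> \<open>The sign of \<open>c k\<close>, so that
        \<open>\<bar>c k\<bar> * s = c k\<close> and the inequality is multiplied by a nonnegative
        constant only.\<close>
      define s :: real where "s = (if c k \<ge> 0 then 1 else -1)"
      have "(Const s)\<^sup>2 = (1 :: 'v mpoly)"
        by (simp add: s_def flip: Const_power)
      then have "Const \<bar>c k\<bar> * (Const s * Var i ^ k) \<preceq>
          Const \<bar>c k\<bar> * (Var i ^ (2 * (k div 2)) + Var i ^ (2 * (Suc k div 2)))"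
        by (intro sos_le_mult_left sos_Const power_le_even_powers) auto
      also have "\<dots> \<preceq> Const (\<delta> * A * (1/2) ^ k) * majorant b n + Const (\<delta> * A * (1/2) ^ k) * majorant b n"
        unfolding distrib_left by (intro sos_le_add half) auto
      also have "\<dots> = Const (2 * \<delta> * A * (1/2) ^ k) * majorant b n"
        by (simp add: Const_mult algebra_simps)
      also have "Const \<bar>c k\<bar> * (Const s * Var i ^ k) = Const (c k) * Var i ^ k"
        by (auto simp: s_def mult.assoc [symmetric] simp flip: Const_mult)
      finally show ?thesis .
    qed
    have "(\<Sum>k\<le>n. Const (c k) * Var i ^ k) \<preceq> (\<Sum>k\<le>n. Const (2 * \<delta> * A * (1/2) ^ k) * majorant b n)"
      by (intro sos_le_sum summand) auto
    also have "\<dots> = Const (\<Sum>k\<le>n. 2 * \<delta> * A * (1/2) ^ k) * majorant b n"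
      by (simp only: Const_sum sum_distrib_right)
    also have "\<dots> \<preceq> Const (\<delta> * (4 * A)) * majorant b n"
    proof (rule sos_le_Const_mult)
      have "2 * \<delta> * A * (\<Sum>k\<le>n. (1/2) ^ k) \<le> 2 * \<delta> * A * 2"
        using \<delta> A by (intro mult_left_mono sum_half_power_le) auto
      then show "(\<Sum>k\<le>n. 2 * \<delta> * A * (1/2) ^ k) \<le> \<delta> * (4 * A)"
        by (simp add: sum_distrib_left)
    qed (use assms in \<open>auto intro: sos_majorant\<close>)
    finally show ?thesis .
  qed
  show thesis
  proof (rule that [of "4 * A"])
    show "0 \<le> 4 * A" using A by simp
    fix \<delta> c n and i :: 'v
    assume \<delta>: "\<delta> \<ge> 0" and c: "\<And>k. k \<le> n \<Longrightarrow> \<bar>c k\<bar> \<le> \<delta> * B ^ k / fact k"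
    have "- (\<Sum>k\<le>n. Const (c k) * Var i ^ k) = (\<Sum>k\<le>n. Const (- c k) * Var i ^ k)"
      by (simp add: Const_uminus sum_negf)
    then show "small b (\<delta> * (4 * A)) (\<Sum>k\<le>n. Const (c k) * Var i ^ k)"
      using * [OF \<delta>, of n c i] * [OF \<delta>, of n "\<lambda>k. - c k" i] c by (intro smallI) auto
  qed
qed

section \<open>Polynomial approximations of sine and cosine\<close>

text \<open>A binomial expansion with weights \<open>a\<close>. Weighting by the real and imaginary
  parts of \<open>\<i> ^ k\<close> yields those of (1 + i y)^n without complex coefficients.\<close>

definition binsum :: "(nat \<Rightarrow> real) \<Rightarrow> nat \<Rightarrow> 'v mpoly \<Rightarrow> 'v mpoly" where
  "binsum a n y = (\<Sum>k\<le>n. Const (a k * real (n choose k)) * y ^ k)"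

lemma binsum_0: "binsum a 0 y = Const (a 0)"
  by (simp add: binsum_def)

text \<open>Pascal's rule; the part that carries a factor \<open>y\<close> sees the weights shifted
  by one.\<close>

lemma binsum_Suc: "binsum a (Suc n) y = binsum a n y + y * binsum (\<lambda>k. a (Suc k)) n y"
proof -
  have "binsum a (Suc n) y = Const (a 0) +
      (\<Sum>k\<le>n. Const (a (Suc k) * real (n choose Suc k)) * y ^ Suc k) +
      (\<Sum>k\<le>n. Const (a (Suc k) * real (n choose k)) * y ^ Suc k)"
    unfolding binsum_def sum.atMost_Suc_shift
    by (simp add: algebra_simps sum.distrib Const_add)
  also have "Const (a 0) + (\<Sum>k\<le>n. Const (a (Suc k) * real (n choose Suc k)) * y ^ Suc k) =
      (\<Sum>k\<le>Suc n. Const (a k * real (n choose k)) * y ^ k)"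
    unfolding sum.atMost_Suc_shift by simp
  also have "\<dots> = binsum a n y"
    by (simp add: binsum_def binomial_eq_0)
  finally show ?thesis
    by (simp add: binsum_def sum_distrib_left mult_ac)
qed

lemma binsum_uminus: "binsum (\<lambda>k. - a k) n y = - binsum a n y"
  by (simp add: binsum_def Const_uminus sum_negf)

lemma binsum_Const_Var:
  "binsum a n (Const h * Var i) = (\<Sum>k\<le>n. Const (a k * real (n choose k) * h ^ k) * Var i ^ k)"
  by (simp add: binsum_def power_mult_distrib Const_mult Const_power mult_ac)

text \<open>The real and imaginary parts of \<open>(1 + \<i> y)\<^sup>n\<close>: polynomial substitutes for cosine and sine
  for which the addition formulas hold exactly, and Pythagoras' identity up to the factor
  \<open>(1 + y\<^sup>2)\<^sup>n\<close>.\<close>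

definition pcos :: "nat \<Rightarrow> 'v mpoly \<Rightarrow> 'v mpoly" where
  "pcos = binsum (\<lambda>k. Re (\<i> ^ k))"

definition psin :: "nat \<Rightarrow> 'v mpoly \<Rightarrow> 'v mpoly" where
  "psin = binsum (\<lambda>k. Im (\<i> ^ k))"

lemma pcos_psin_0: "pcos 0 y = 1" "psin 0 y = 0"
  by (simp_all add: pcos_def psin_def binsum_0)

text \<open>Multiplication by 1 + i y: shifting the weights multiplies \<open>\<i> ^ k\<close> by
  \<open>\<i>\<close>, which turns real parts into negated imaginary parts and imaginary parts into
  real parts.\<close>

lemma pcos_psin_Suc: "pcos (Suc n) y = pcos n y - y * psin n y"
  "psin (Suc n) y = psin n y + y * pcos n y"
  by (simp_all add: pcos_def psin_def binsum_Suc binsum_uminus)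

lemma pcos_psin_squares: "(pcos n y)\<^sup>2 + (psin n y)\<^sup>2 = (1 + y\<^sup>2) ^ n"
proof (induction n)
  case (Suc n)
  have "(pcos (Suc n) y)\<^sup>2 + (psin (Suc n) y)\<^sup>2 = (1 + y\<^sup>2) * ((pcos n y)\<^sup>2 + (psin n y)\<^sup>2)"
    by (simp add: pcos_psin_Suc power2_eq_square algebra_simps)
  then show ?case by (simp add: Suc.IH)
qed (simp add: pcos_psin_0)

lemma pcos_psin_add: "pcos (m + n) y = pcos m y * pcos n y - psin m y * psin n y"
  "psin (m + n) y = psin m y * pcos n y + pcos m y * psin n y"
proof (induction n)
  case (Suc n)
  {
    case 1
    show ?case unfolding add_Suc_right pcos_psin_Suc Suc by (simp add: algebra_simps)
  next
    case 2
    show ?case unfolding add_Suc_right pcos_psin_Suc Suc by (simp add: algebra_simps)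
  }
qed (simp_all add: pcos_psin_0)

section \<open>Estimates for the polynomial substitutes of sine and cosine\<close>

lemma binomial_power_bound:
  fixes h :: real
  shows "real (n choose k) * \<bar>h\<bar> ^ k \<le> (real n * \<bar>h\<bar>) ^ k / fact k"
proof -
  have "real (n choose k) * fact k \<le> real n ^ k"
    using binomial_fact_pow [of n k] by (metis of_nat_fact of_nat_le_iff of_nat_mult of_nat_power)
  then have "real (n choose k) * fact k * \<bar>h\<bar> ^ k \<le> real n ^ k * \<bar>h\<bar> ^ k"
    by (intro mult_right_mono) auto
  then show ?thesis by (simp add: field_simps power_mult_distrib)
qed

lemma abs_Re_Im_i_power: "\<bar>Re (\<i> ^ k)\<bar> \<le> 1" "\<bar>Im (\<i> ^ k)\<bar> \<le> 1"
  using abs_Re_le_cmod [of "\<i> ^ k"] abs_Im_le_cmod [of "\<i> ^ k"] by (simp_all add: norm_power)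

text \<open>By \<open>binomial_power_bound\<close> the coefficients are at most
  \<open>B ^ k / fact k\<close>, those of exp (B x), uniformly in the index;
  \<open>small_power_series\<close> applies for every \<open>b\<close>.\<close>

lemma bdd_binsum:
  fixes i :: "'v::finite"
  assumes a: "\<And>k. \<bar>a k\<bar> \<le> 1" and B: "\<And>x. real (n x) * \<bar>h x\<bar> \<le> B"
  shows "bdd F (\<lambda>x. binsum a (n x) (Const (h x) * Var i))"
proof (rule bddI)
  fix b :: real assume b: "b > 0"
  have "0 \<le> real (n x) * \<bar>h x\<bar>" for x by simp
  then have B0: "B \<ge> 0" using B by (meson order.trans)
  obtain A where A: "A \<ge> 0"
    "\<And>\<delta> c n (i :: 'v). \<delta> \<ge> 0 \<Longrightarrow> (\<And>k. k \<le> n \<Longrightarrow> \<bar>c k\<bar> \<le> \<delta> * B ^ k / fact k) \<Longrightarrow>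
      small b (\<delta> * A) (\<Sum>k\<le>n. Const (c k) * Var i ^ k)"
    using small_power_series [OF B0 b] by blast
  have "small b (1 * A) (binsum a (n x) (Const (h x) * Var i))" for x
    unfolding binsum_Const_Var
  proof (rule A(2))
    fix k
    have "\<bar>a k * real (n x choose k) * h x ^ k\<bar> \<le> 1 * (real (n x choose k) * \<bar>h x\<bar> ^ k)"
      unfolding abs_mult power_abs mult.assoc using a by (intro mult_mono) auto
    also have "\<dots> \<le> (real (n x) * \<bar>h x\<bar>) ^ k / fact k"
      using binomial_power_bound by simp
    also have "\<dots> \<le> B ^ k / fact k"
      using B by (intro divide_right_mono power_mono) auto
    finally show "\<bar>a k * real (n x choose k) * h x ^ k\<bar> \<le> 1 * B ^ k / fact k" by simp
  qed simp
  then show "\<exists>A\<ge>0. \<forall>\<^sub>F x in F. small b A (binsum a (n x) (Const (h x) * Var i))"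
    using A(1) by (intro exI [of _ A]) auto
qed

text \<open>The polynomial stands for sin (2 a x) / (2 a). Its coefficients of degree 0 and 1 agree
  exactly with those of x, and for k \<ge> 2 they are at most (2 a)^(k - 1) / k! \<le> 2 a / k!. The
  error is thus 2 a times a series of exponential type 1, uniformly in \<open>m\<close>.\<close>

lemma small_psin_diff:
  assumes "b > 0"
  obtains A where "A \<ge> 0"
    and "\<And>a m (i :: 'v::finite). 0 < a \<Longrightarrow> a \<le> 1/2 \<Longrightarrow> m \<ge> 1 \<Longrightarrow>
      small b (2 * a * A) (Const (1 / (2 * a)) * psin (2 * m) (Const (a / real m) * Var i) - Var i)"
proof -
  obtain A where A: "A \<ge> 0"
    "\<And>\<delta> c n (i :: 'v). \<delta> \<ge> 0 \<Longrightarrow> (\<And>k. k \<le> n \<Longrightarrow> \<bar>c k\<bar> \<le> \<delta> * 1 ^ k / fact k) \<Longrightarrow>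
      small b (\<delta> * A) (\<Sum>k\<le>n. Const (c k) * Var i ^ k)"
    using small_power_series [of 1 b] assms by auto
  show thesis
  proof (rule that [OF A(1)])
    fix a :: real and m :: nat and i :: 'v
    assume a: "0 < a" "a \<le> 1/2" and m: "m \<ge> 1"
    define c where "c k = 1 / (2 * a) * (Im (\<i> ^ k) * real (2 * m choose k) * (a / real m) ^ k) -
      (if k = 1 then 1 else 0)" for k
    have "Var i = (\<Sum>k\<le>2 * m. Const (if k = 1 then 1 else 0) * Var i ^ k)"
      using m by (simp add: if_distrib [of Const] if_distrib [of "\<lambda>x. x * _"] cong: if_cong)
    then have "Const (1 / (2 * a)) * psin (2 * m) (Const (a / real m) * Var i) - Var i =
        (\<Sum>k\<le>2 * m. Const (1 / (2 * a)) * (Const (Im (\<i> ^ k) * real (2 * m choose k) * (a / real m) ^ k) * Var i ^ k)) -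
        (\<Sum>k\<le>2 * m. Const (if k = 1 then 1 else 0) * Var i ^ k)"
      unfolding psin_def binsum_Const_Var sum_distrib_left [symmetric] by simp
    also have "\<dots> = (\<Sum>k\<le>2 * m. Const (c k) * Var i ^ k)"
      unfolding sum_subtractf [symmetric] c_def Const_diff left_diff_distrib
      by (simp only: Const_mult mult.assoc)
    finally have eq: "Const (1 / (2 * a)) * psin (2 * m) (Const (a / real m) * Var i) - Var i =
        (\<Sum>k\<le>2 * m. Const (c k) * Var i ^ k)" .
    have c: "\<bar>c k\<bar> \<le> 2 * a * 1 ^ k / fact k" for k
    proof -
      consider "k = 0" | "k = 1" | "k \<ge> 2" by linarith
      then show ?thesis
      proof cases
        case 3
        have "\<bar>c k\<bar> = 1 / (2 * a) * (\<bar>Im (\<i> ^ k)\<bar> * (real (2 * m choose k) * \<bar>a / real m\<bar> ^ k))"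
          using 3 a by (simp add: c_def abs_mult power_abs)
        also have "\<dots> \<le> 1 / (2 * a) * (1 * ((real (2 * m) * \<bar>a / real m\<bar>) ^ k / fact k))"
          using a by (intro mult_left_mono mult_mono abs_Re_Im_i_power binomial_power_bound) auto
        also have "\<dots> = 1 / (2 * a) * ((2 * a) ^ k / fact k)"
          using a m by simp
        also have "\<dots> = (2 * a) ^ (k - 1) / fact k"
          using a 3 by (cases k) auto
        also have "\<dots> \<le> 2 * a / fact k"
          using a 3 power_decreasing [of 1 "k - 1" "2 * a"] by (intro divide_right_mono) auto
        finally show ?thesis by simp
      qed (use a m in \<open>auto simp: c_def\<close>)
    qed
    show "small b (2 * a * A) (Const (1 / (2 * a)) * psin (2 * m) (Const (a / real m) * Var i) - Var i)"
      unfolding eq using a c by (intro A(2)) auto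
  qed
qed

text \<open>In the binomial expansion without its constant term, the term of degree
  \<open>2 * k\<close> costs at most \<tau>^k of the majorant, and for k \<ge> 1 this is at most 2
  \<tau> (1/2)^k. The difference is itself a sum of squares, so its negative satisfies the same
  bound.\<close>

lemma small_one_plus_power:
  fixes i :: "'v::finite"
  assumes b: "b > 0" and \<tau>: "\<tau> = real M * h\<^sup>2 / b" "\<tau> \<le> 1/2"
  shows "small b (4 * \<tau>) ((1 + (Const h * Var i)\<^sup>2) ^ M - 1)"
proof -
  have \<tau>0: "\<tau> \<ge> 0" using b \<tau> by simp
  define c where "c k = (if k = 0 then 0 else real (M choose k) * (h\<^sup>2) ^ k)" for k
  have c0: "c k \<ge> 0" for k by (simp add: c_def)
  have z: "((Const h * Var i)\<^sup>2) ^ k = Const ((h\<^sup>2) ^ k) * Var i ^ (2 * k)" for k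
    by (simp only: power_mult_distrib power_mult Const_power)
  have "(1 + (Const h * Var i)\<^sup>2) ^ M = (\<Sum>k\<le>M. Const (real (M choose k) * (h\<^sup>2) ^ k) * Var i ^ (2 * k))"
    unfolding add.commute [of 1] binomial_ring z by (simp add: Const_mult Const_of_nat mult.assoc)
  also have "\<dots> = (\<Sum>k\<le>M. Const (if k = 0 then 1 else 0) + Const (c k) * Var i ^ (2 * k))"
    by (intro sum.cong) (auto simp: c_def)
  also have "\<dots> = 1 + (\<Sum>k\<le>M. Const (c k) * Var i ^ (2 * k))"
    by (simp add: sum.distrib if_distrib [of Const] cong: if_cong)
  finally have eq: "(1 + (Const h * Var i)\<^sup>2) ^ M - 1 = (\<Sum>k\<le>M. Const (c k) * Var i ^ (2 * k))"
    by simp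
  have sos: "sum_of_squares (\<Sum>k\<le>M. Const (c k) * Var i ^ (2 * k))"
    using c0 by (intro sos_intros sos_even_power) auto
  have "(\<Sum>k\<le>M. Const (c k) * Var i ^ (2 * k)) \<preceq> (\<Sum>k\<le>M. Const (c k) * (Const (fact k / b ^ k) * majorant b M))"
    using c0 b by (intro sos_le_sum sos_le_mult_left sos_Const even_power_le_majorant) auto
  also have "\<dots> = Const (\<Sum>k\<le>M. c k * (fact k / b ^ k)) * majorant b M"
    by (simp only: Const_sum Const_mult sum_distrib_right mult.assoc)
  also have "\<dots> \<preceq> Const (4 * \<tau>) * majorant b M"
  proof (rule sos_le_Const_mult)
    have "c k * (fact k / b ^ k) \<le> 2 * \<tau> * (1/2) ^ k" for k
    proof (cases k)
      case (Suc l)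
      have "c k * (fact k / b ^ k) = real (M choose k) * \<bar>h\<^sup>2 / b\<bar> ^ k * fact k"
        using b Suc by (simp add: c_def power_divide)
      also have "\<dots> \<le> (real M * \<bar>h\<^sup>2 / b\<bar>) ^ k / fact k * fact k"
        by (intro mult_right_mono binomial_power_bound) simp
      also have "\<dots> = \<tau> * \<tau> ^ l"
        using b by (simp add: \<tau>(1) Suc)
      also have "\<dots> \<le> \<tau> * (1/2) ^ l"
        using \<tau>0 \<tau>(2) by (intro mult_left_mono power_mono) auto
      finally show ?thesis by (simp add: Suc)
    qed (use \<tau>0 in \<open>simp add: c_def\<close>)
    then have "(\<Sum>k\<le>M. c k * (fact k / b ^ k)) \<le> (\<Sum>k\<le>M. 2 * \<tau> * (1/2) ^ k)"
      by (intro sum_mono)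
    also have "\<dots> = 2 * \<tau> * (\<Sum>k\<le>M. (1/2) ^ k)"
      by (simp only: sum_distrib_left)
    also have "\<dots> \<le> 2 * \<tau> * 2"
      using \<tau>0 by (intro mult_left_mono sum_half_power_le) auto
    finally show "(\<Sum>k\<le>M. c k * (fact k / b ^ k)) \<le> 4 * \<tau>" by simp
  qed (use b in \<open>auto intro: sos_majorant\<close>)
  finally have le: "(\<Sum>k\<le>M. Const (c k) * Var i ^ (2 * k)) \<preceq> Const (4 * \<tau>) * majorant b M" .
  have "- p \<preceq> q" if "sum_of_squares p" "p \<preceq> q" for p q :: "'v mpoly"
    using sos_add [OF that(1) sos_le_sos [OF that]] by (simp add: sos_le_def add.commute)
  then show ?thesis
    unfolding eq using le sos by (intro smallI) auto
qed

text \<open>With step a / d^2 and at most d^3 factors, \<tau> is at most a^2 / (b d) and tends to 0.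
  The exponent d^3 arises because a \<open>d\<close>-th Bernstein power is taken of the Pythagorean
  factor, which is itself a power with exponent d^2.\<close>

lemma conv_one_plus_power:
  fixes i :: "'v::finite"
  assumes M: "\<And>d. M d \<le> d\<^sup>2 * d"
  shows "conv sequentially (\<lambda>d. (1 + (Const (a / real (d\<^sup>2)) * Var i)\<^sup>2) ^ M d) (\<lambda>_. 1)"
proof (rule convI [OF bdd_1])
  show "null sequentially (\<lambda>d. (1 + (Const (a / real (d\<^sup>2)) * Var i)\<^sup>2) ^ M d - 1)"
    unfolding null_def
  proof (intro allI impI)
    fix b \<delta> :: real assume b: "b > 0" "\<delta> > 0"
    have "(\<lambda>d. a\<^sup>2 / b * (1 / real d)) \<longlonglongrightarrow> a\<^sup>2 / b * 0"
      by (intro tendsto_mult_left lim_1_over_n)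
    then have "\<forall>\<^sub>F d in sequentially. a\<^sup>2 / b * (1 / real d) < min (1/2) (\<delta> / 4)"
      using b by (intro order_tendstoD) auto
    then show "\<forall>\<^sub>F d in sequentially.
        small b \<delta> ((1 + (Const (a / real (d\<^sup>2)) * Var i)\<^sup>2) ^ M d - 1)"
      using eventually_gt_at_top [of 0]
    proof eventually_elim
      case (elim d)
      define \<tau> where "\<tau> = real (M d) * (a / real (d\<^sup>2))\<^sup>2 / b"
      have "\<tau> \<le> real (d\<^sup>2 * d) * (a / real (d\<^sup>2))\<^sup>2 / b"
        unfolding \<tau>_def using b M [of d]
        by (intro divide_right_mono mult_right_mono) (simp_all only: of_nat_le_iff zero_le_power2 less_imp_le)
      also have "\<dots> = a\<^sup>2 / b * (1 / real d)"
        using elim by (simp add: field_simps power2_eq_square)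
      finally have "\<tau> \<le> a\<^sup>2 / b * (1 / real d)" .
      then have \<tau>: "\<tau> \<le> 1/2" "4 * \<tau> \<le> \<delta>"
        using elim(1) unfolding min_less_iff_conj by linarith+
      show ?case
        by (rule small_mono [OF small_one_plus_power [OF b(1) \<tau>_def \<tau>(1)]])
          (use b \<tau> in \<open>auto simp: \<tau>_def\<close>)
    qed
  qed
qed

section \<open>Bernstein approximation and perturbed nonnegative polynomials\<close>

text \<open>The shift \<open>l\<close> is what makes the induction on the degree go through: the identity
  \<open>j (n choose j) = n (n - 1 choose j - 1)\<close> trades one factor of the monomial for a shift of the nodes.\<close>

lemma conv_bernstein:
  fixes u v :: "nat \<Rightarrow> 'v::finite mpoly" and a :: real
  assumes u: "bdd sequentially u" and a: "a > 0"
    and uv: "\<And>l. conv sequentially (\<lambda>d. (u d + v d) ^ (d - l)) (\<lambda>_. 1)"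
  shows "conv sequentially
    (\<lambda>d. \<Sum>j\<le>d - l. Const (real (d - l choose j) * ((real (j + l) / real d - 1/2) / a) ^ k) *
      u d ^ j * v d ^ (d - l - j))
    (\<lambda>d. (Const (1 / a) * u d - Const (1 / (2 * a))) ^ k)"
proof (induction k arbitrary: l)
  case 0
  have "(\<Sum>j\<le>d - l. Const (real (d - l choose j) * ((real (j + l) / real d - 1/2) / a) ^ 0) *
      u d ^ j * v d ^ (d - l - j)) = (u d + v d) ^ (d - l)" for d
    by (simp add: binomial_ring Const_of_nat)
  then show ?case using uv by simp
next
  case (Suc k)
  define y where "y d l j = (real (j + l) / real d - 1/2) / a" for d l j :: nat
  define M where "M l k d = (\<Sum>j\<le>d - l. Const (real (d - l choose j) * y d l j ^ k) *
      u d ^ j * v d ^ (d - l - j))" for l k d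
  \<comment> \<open>The node splits as \<open>y d l j = real j / (a * real d) + c2 d\<close>, and
    the summand with \<open>real j\<close> produces the factor
    \<open>c1 d = real (d - l) / (a * real d)\<close>. The limits are 1 / a and - 1 / (2 a), the
    coefficients of the base of the power on the right.\<close>
  define c1 where "c1 d = 1 / a - real l / a * (1 / real d)" for d
  define c2 where "c2 d = real l / a * (1 / real d) - 1 / (2 * a)" for d
  \<comment> \<open>Subtraction in \<open>d - l\<close> is truncated, so the recursion is stated for
    \<open>l < d\<close> only, which suffices for a limit in \<open>d\<close>.\<close>
  have step: "Const (c1 d) * u d * M (Suc l) k d + Const (c2 d) * M l k d = M l (Suc k) d" if d: "Suc l \<le> d" for d
  proof -
    define n where "n = d - Suc l"
    have n: "d - l = Suc n" "d - Suc l = n" using d by (auto simp: n_def)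
    have y: "y d l (Suc j) = y d (Suc l) j" for j by (simp add: y_def)
    have yc: "y d l j = real j / (a * real d) + c2 d" for j
      using a d by (simp add: y_def c2_def field_simps)
    have c1: "c1 d = real (Suc n) / (a * real d)"
      using a d by (simp add: c1_def n_def field_simps of_nat_diff)
    let ?f = "\<lambda>j. Const (real (Suc n choose j) * (real j / (a * real d)) * y d l j ^ k) *
      u d ^ j * v d ^ (Suc n - j)"
    have "M l (Suc k) d = (\<Sum>j\<le>Suc n. ?f j) + Const (c2 d) * M l k d"
      unfolding M_def n sum_distrib_left sum.distrib [symmetric]
    proof (rule sum.cong [OF refl])
      fix j
      have "real (Suc n choose j) * y d l j ^ Suc k =
          real (Suc n choose j) * (real j / (a * real d)) * y d l j ^ k + c2 d * (real (Suc n choose j) * y d l j ^ k)"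
        by (simp add: yc distrib_left distrib_right mult_ac)
      then show "Const (real (Suc n choose j) * y d l j ^ Suc k) * u d ^ j * v d ^ (Suc n - j) =
          ?f j + Const (c2 d) * (Const (real (Suc n choose j) * y d l j ^ k) * u d ^ j * v d ^ (Suc n - j))"
        by (simp only: Const_add Const_mult [of "c2 d"] distrib_right mult.assoc)
    qed
    \<comment> \<open>The term with \<open>j = 0\<close> vanishes because of its factor
      \<open>real j\<close>.\<close>
    also have "(\<Sum>j\<le>Suc n. ?f j) = (\<Sum>j\<le>n. ?f (Suc j))"
      unfolding sum.atMost_Suc_shift by simp
    also have "\<dots> = Const (c1 d) * u d * M (Suc l) k d"
      unfolding M_def n sum_distrib_left
    proof (rule sum.cong [OF refl])
      fix j
      have "real (Suc n choose Suc j) * real (Suc j) = real (Suc n) * real (n choose j)"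
        using Suc_times_binomial_eq [of n j] by (metis of_nat_mult)
      then have "real (Suc n choose Suc j) * (real (Suc j) / (a * real d)) = c1 d * real (n choose j)"
        unfolding c1 by (metis times_divide_eq_left times_divide_eq_right)
      then have eq: "Const (real (Suc n choose Suc j) * (real (Suc j) / (a * real d)) * y d l (Suc j) ^ k) =
          Const (c1 d) * Const (real (n choose j) * y d (Suc l) j ^ k)"
        by (simp only: y Const_mult mult.assoc)
      show "?f (Suc j) = Const (c1 d) * u d *
          (Const (real (n choose j) * y d (Suc l) j ^ k) * u d ^ j * v d ^ (n - j))"
        unfolding eq diff_Suc_Suc power_Suc by (simp only: mult_ac)
    qed
    finally show ?thesis by simp
  qed
  have IH: "conv sequentially (M l k) (\<lambda>d. (Const (1 / a) * u d - Const (1 / (2 * a))) ^ k)" for l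
    using Suc.IH [of l] by (simp add: M_def [abs_def] y_def)
  have "c1 \<longlonglongrightarrow> 1 / a - real l / a * 0" "c2 \<longlonglongrightarrow> real l / a * 0 - 1 / (2 * a)"
    unfolding c1_def c2_def by (intro tendsto_intros lim_1_over_n)+
  then have "conv sequentially (\<lambda>d. Const (c1 d) * u d * M (Suc l) k d + Const (c2 d) * M l k d)
      (\<lambda>d. Const (1 / a) * u d * (Const (1 / a) * u d - Const (1 / (2 * a))) ^ k +
         Const (- (1 / (2 * a))) * (Const (1 / a) * u d - Const (1 / (2 * a))) ^ k)"
    by (intro conv_add conv_mult conv_Const IH conv_refl u) auto
  then have "conv sequentially (M l (Suc k))
      (\<lambda>d. Const (1 / a) * u d * (Const (1 / a) * u d - Const (1 / (2 * a))) ^ k +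
         Const (- (1 / (2 * a))) * (Const (1 / a) * u d - Const (1 / (2 * a))) ^ k)"
    by (rule conv_cong_eventually)
      (use step in \<open>auto intro!: eventually_mono [OF eventually_ge_at_top [of "Suc l"]]\<close>)
  moreover have "Const (1 / a) * u d * z + Const (- (1 / (2 * a))) * z =
      (Const (1 / a) * u d - Const (1 / (2 * a))) * z" for d z
    by (simp add: Const_uminus algebra_simps)
  ultimately show ?case
    by (simp add: M_def [abs_def] y_def)
qed

text \<open>The Bernstein sum of \<open>p\<close> in several variables: its coefficients are values
  of \<open>p\<close> at nodes, hence nonnegative, and its weights are products of the sums of
  squares \<open>u\<close> and \<open>v\<close>, which replace t and 1 - t in the Bernstein
  basis.\<close>

lemma sos_near_psin:
  fixes p :: "'v::finite mpoly" and a :: real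
  assumes p: "\<And>x. eval p x \<ge> 0" and a: "a > 0"
  obtains \<sigma> where "\<And>d. sum_of_squares (\<sigma> d)"
    and "conv sequentially \<sigma>
      (\<lambda>d. subst Const (\<lambda>i. Const (1 / (2 * a)) * psin (2 * d\<^sup>2) (Const (a / real (d\<^sup>2)) * Var i)) p)"
proof -
  define S where "S i d = psin (d\<^sup>2) (Const (a / real (d\<^sup>2)) * Var i)" for i :: 'v and d
  define C where "C i d = pcos (d\<^sup>2) (Const (a / real (d\<^sup>2)) * Var i)" for i :: 'v and d
  \<comment> \<open>\<open>S\<close> and \<open>C\<close> approximate sin (a x) and cos (a x). Then
    \<open>u + v\<close> is nearly 1 by Pythagoras, and \<open>u - v = 2 S C\<close> is exactly
    \<open>psin\<close> with doubled index.\<close>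
  define u where "u i d = Const (1/2) * (S i d + C i d)\<^sup>2" for i d
  define v where "v i d = Const (1/2) * (S i d - C i d)\<^sup>2" for i d
  define X where "X i d = Const (1 / (2 * a)) * psin (2 * d\<^sup>2) (Const (a / real (d\<^sup>2)) * Var i)" for i :: 'v and d
  have bd: "real (d\<^sup>2) * \<bar>a / real (d\<^sup>2)\<bar> \<le> a" for d
    using a by (cases "d = 0") auto
  have bS: "bdd sequentially (S i)" and bC: "bdd sequentially (C i)" for i
    unfolding S_def C_def psin_def pcos_def
    by (rule bdd_binsum [OF _ bd]; rule abs_Re_Im_i_power)+
  have bu: "bdd sequentially (u i)" for i
    unfolding u_def power2_eq_square by (intro bdd_mult bdd_add bdd_Const bS bC)
  have "(S i d + C i d)\<^sup>2 + (S i d - C i d)\<^sup>2 = 2 * ((C i d)\<^sup>2 + (S i d)\<^sup>2)" for i d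
    by (simp add: power2_eq_square algebra_simps)
  then have upv: "u i d + v i d = (1 + (Const (a / real (d\<^sup>2)) * Var i)\<^sup>2) ^ d\<^sup>2" for i d
    unfolding u_def v_def distrib_left [symmetric]
    by (simp only: Const_half_mult_2) (simp add: S_def C_def pcos_psin_squares)
  have "(S i d + C i d)\<^sup>2 - (S i d - C i d)\<^sup>2 = 2 * (S i d * C i d + C i d * S i d)" for i d
    by (simp add: power2_eq_square algebra_simps)
  then have umv: "u i d - v i d = psin (2 * d\<^sup>2) (Const (a / real (d\<^sup>2)) * Var i)" for i d
    unfolding u_def v_def right_diff_distrib [symmetric]
    by (simp only: Const_half_mult_2 S_def C_def pcos_psin_add mult_2 [of "d\<^sup>2"])
  have cuv: "conv sequentially (\<lambda>d. (u i d + v i d) ^ (d - l)) (\<lambda>_. 1)" for i l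
    unfolding upv power_mult [symmetric] by (rule conv_one_plus_power) simp
  have "conv sequentially (\<lambda>d. u i d + v i d) (\<lambda>_. 1)" for i
    unfolding upv by (rule conv_one_plus_power) (simp add: power2_eq_square)
  then have n1: "null sequentially (\<lambda>d. u i d + v i d - 1)" for i
    by (simp add: conv_def)
  have bX: "bdd sequentially (X i)" for i
  proof -
    have "real (2 * d\<^sup>2) * \<bar>a / real (d\<^sup>2)\<bar> \<le> 2 * a" for d
      using a by (cases "d = 0") auto
    then show ?thesis
      unfolding X_def psin_def
      by (intro bdd_mult bdd_Const bdd_binsum abs_Re_Im_i_power)
  qed
  have cX: "conv sequentially (\<lambda>d. Const (1 / a) * u i d - Const (1 / (2 * a))) (X i)" for i
  proof (rule convI [OF bX])
    \<comment> \<open>Since X = (u - v) / (2 a), replacing it by u / a - 1 / (2 a) leaves the error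
      (u + v - 1) / (2 a), which is null.\<close>
    have "Const (1 / a) = Const (1 / (2 * a)) * (2 :: 'v mpoly)"
      unfolding Const_numeral [symmetric] Const_mult [symmetric] by simp
    then have "Const (1 / a) * u i d - Const (1 / (2 * a)) - X i d = (u i d + v i d - 1) * Const (1 / (2 * a))" for d
      unfolding X_def umv [symmetric] by (simp add: algebra_simps)
    then show "null sequentially (\<lambda>d. Const (1 / a) * u i d - Const (1 / (2 * a)) - X i d)"
      using null_mult [OF n1 bdd_Const] by simp
  qed
  define y where "y d j = (real j / real d - 1/2) / a" for d j :: nat
  define \<sigma> where "\<sigma> d = (\<Sum>j\<in>(\<Pi>\<^sub>E i\<in>UNIV. {..d}). Const (eval p (\<lambda>i. y d (j i))) *
      (\<Prod>i\<in>UNIV. Const (real (d choose j i)) * u i d ^ j i * v i d ^ (d - j i)))" for d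
  \<comment> \<open>The same sum arranged by monomials of \<open>p\<close>. On each monomial the
    variables decouple into one-dimensional Bernstein sums, written so as to match
    \<open>conv_bernstein\<close> with shift 0.\<close>
  define G where "G d = (\<Sum>t\<in>Poly_Mapping.keys p. Const (Poly_Mapping.lookup p t) *
      (\<Prod>i\<in>UNIV. \<Sum>j\<le>d - 0. Const (real (d - 0 choose j) * ((real (j + 0) / real d - 1/2) / a) ^ Poly_Mapping.lookup t i) *
         u i d ^ j * v i d ^ (d - 0 - j)))" for d
  show thesis
  proof (rule that [of \<sigma>])
    show "sum_of_squares (\<sigma> d)" for d
      unfolding \<sigma>_def u_def v_def by (intro sos_intros p) auto
    have \<sigma>_eq: "\<sigma> d = G d" for d
    proof -
      have "(\<Prod>i\<in>UNIV. \<Sum>j\<le>d. Const (real (d choose j) * y d j ^ Poly_Mapping.lookup t i) * u i d ^ j * v i d ^ (d - j))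
        = (\<Sum>j\<in>(\<Pi>\<^sub>E i\<in>UNIV. {..d}). Const (\<Prod>i\<in>UNIV. y d (j i) ^ Poly_Mapping.lookup t i) *
          (\<Prod>i\<in>UNIV. Const (real (d choose j i)) * u i d ^ j i * v i d ^ (d - j i)))" for t
        by (subst prod_sum_PiE)
          (auto simp: Const_prod Const_mult mult_ac prod.distrib [symmetric] intro!: sum.cong prod.cong)
      then show ?thesis
        by (simp add: G_def \<sigma>_def eval_def subst_def prod_keys_UNIV Const_sum Const_mult sum_distrib_left
            sum_distrib_right mult.assoc y_def [symmetric]) (rule sum.swap)
    qed
    have "conv sequentially G
      (\<lambda>d. \<Sum>t\<in>Poly_Mapping.keys p. Const (Poly_Mapping.lookup p t) * (\<Prod>i\<in>UNIV. X i d ^ Poly_Mapping.lookup t i))"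
      unfolding G_def
      by (intro conv_sum conv_mult conv_prod conv_refl bdd_Const
          conv_trans [OF conv_bernstein [OF bu a cuv] conv_power [OF cX]])
    then show "conv sequentially \<sigma>
      (\<lambda>d. subst Const (\<lambda>i. Const (1 / (2 * a)) * psin (2 * d\<^sup>2) (Const (a / real (d\<^sup>2)) * Var i)) p)"
      by (simp add: \<sigma>_eq [abs_def] subst_def prod_keys_UNIV X_def)
  qed
qed

text \<open>The principal filter in the second component expresses uniformity in m \<ge> 1:
  \<open>a\<close> can be fixed first and the index chosen afterwards.\<close>

lemma conv_psin_Var:
  fixes i :: "'v::finite"
  defines "F \<equiv> at_right (0 :: real) \<times>\<^sub>F principal {1 :: nat..}"
  shows "conv F (\<lambda>(a, m). Const (1 / (2 * a)) * psin (2 * m) (Const (a / real m) * Var i)) (\<lambda>_. Var i)"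
proof (rule convI)
  \<comment> \<open>A variable is itself a value of \<open>psin\<close>, so its boundedness is a
    case of \<open>bdd_binsum\<close>.\<close>
  have "psin 1 (Const 1 * Var i) = Var i"
    using pcos_psin_Suc [of 0] by (simp add: pcos_psin_0)
  moreover have "bdd F (\<lambda>_. psin 1 (Const 1 * Var i))"
    unfolding psin_def by (rule bdd_binsum [where B = 1]) (auto intro: abs_Re_Im_i_power)
  ultimately show "bdd F (\<lambda>_. Var i)" by simp
  show "null F (\<lambda>n. (case n of (a, m) \<Rightarrow> Const (1 / (2 * a)) * psin (2 * m) (Const (a / real m) * Var i)) - Var i)"
    unfolding null_def
  proof (intro allI impI)
    fix b \<delta> :: real assume b: "b > 0" "\<delta> > 0"
    obtain A where A: "A \<ge> 0"
      "\<And>a m (i :: 'v). 0 < a \<Longrightarrow> a \<le> 1/2 \<Longrightarrow> m \<ge> 1 \<Longrightarrow>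
        small b (2 * a * A) (Const (1 / (2 * a)) * psin (2 * m) (Const (a / real m) * Var i) - Var i)"
      using small_psin_diff [OF b(1)] by blast
    have "eventually (\<lambda>a. 0 < a \<and> a < min (1/2) (\<delta> / (2 * (A + 1)))) (at_right (0::real))"
      unfolding eventually_at_right_field using A b
      by (intro exI [of _ "min (1/2) (\<delta> / (2 * (A + 1)))"]) auto
    moreover have "eventually (\<lambda>m. m \<ge> 1) (principal {1 :: nat..})"
      by (simp add: eventually_principal)
    moreover have "small b \<delta> (Const (1 / (2 * a)) * psin (2 * m) (Const (a / real m) * Var i) - Var i)"
      if "0 < a \<and> a < min (1/2) (\<delta> / (2 * (A + 1)))" "m \<ge> 1" for a m
    proof (rule small_mono [OF A(2)])
      have "2 * a * A \<le> 2 * a * (A + 1)" using that by simp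
      also have "\<dots> \<le> \<delta>" using that A by (simp add: field_simps)
      finally show "2 * a * A \<le> \<delta>" .
    qed (use that A b in auto)
    ultimately show "\<forall>\<^sub>F n in F. small b \<delta> ((case n of (a, m) \<Rightarrow>
        Const (1 / (2 * a)) * psin (2 * m) (Const (a / real m) * Var i)) - Var i)"
      unfolding F_def eventually_prod_filter
      by (intro exI [of _ "\<lambda>a. 0 < a \<and> a < min (1/2) (\<delta> / (2 * (A + 1)))"] exI [of _ "\<lambda>m. m \<ge> 1"]) auto
  qed
qed

text \<open>Two approximations of error \<epsilon>/2 each: first \<open>a\<close> is chosen so small
  that the substitution moves \<open>p\<close> little, whatever the index; then \<open>d\<close> so
  large that the sum of squares \<open>\<sigma> d\<close> is near the substituted polynomial. Their
  sum bounds \<open>p - \<sigma> d\<close>, and \<epsilon> \<theta> absorbs it.\<close>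

theorem nonneg_perturbation_sos:
  fixes p :: "'v::finite mpoly"
  assumes p: "\<And>x. eval p x \<ge> 0" and \<epsilon>: "\<epsilon> > 0"
  obtains r where "\<And>s. r \<le> s \<Longrightarrow> sum_of_squares (p + Const \<epsilon> * \<theta> s)"
proof -
  \<comment> \<open>The largest parameter for which \<open>majorant_le_theta\<close>
    applies.\<close>
  define b where "b = 1 / (2 * real CARD('v))"
  have b: "b > 0" "2 * real CARD('v) * b \<le> 1" by (auto simp: b_def)
  define F where "F = at_right (0 :: real) \<times>\<^sub>F principal {1 :: nat..}"
  define X where "X a m i = Const (1 / (2 * a)) * psin (2 * m) (Const (a / real m) * Var i)" for a m and i :: 'v
  have "conv F (\<lambda>n. subst Const (\<lambda>i. case n of (a, m) \<Rightarrow> X a m i) p) (\<lambda>n. subst Const Var p)"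
    unfolding F_def X_def by (intro conv_subst conv_psin_Var)
  then have "\<forall>\<^sub>F n in F. small b (\<epsilon>/2) (subst Const (\<lambda>i. case n of (a, m) \<Rightarrow> X a m i) p - p)"
    using b \<epsilon> unfolding conv_def null_def subst_Const_Var by simp
  then obtain P Q where PQ: "eventually P (at_right (0::real))" "eventually Q (principal {1 :: nat..})"
    "\<And>a m. P a \<Longrightarrow> Q m \<Longrightarrow> small b (\<epsilon>/2) (subst Const (X a m) p - p)"
    unfolding F_def eventually_prod_filter by auto
  have "\<forall>\<^sub>F a in at_right (0::real). P a \<and> 0 < a"
    using PQ(1) eventually_at_right_less by (rule eventually_conj)
  then obtain a where a: "P a" "a > 0"
    using eventually_happens' [OF trivial_limit_at_right_real] by blast
  obtain \<sigma> where \<sigma>: "\<And>d. sum_of_squares (\<sigma> d)" "conv sequentially \<sigma> (\<lambda>d. subst Const (X a (d\<^sup>2)) p)"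
    using sos_near_psin [of p a] p a(2) unfolding X_def by blast
  have "\<forall>\<^sub>F d in sequentially. small b (\<epsilon>/2) (\<sigma> d - subst Const (X a (d\<^sup>2)) p) \<and> d \<ge> 1"
    using \<sigma>(2) b \<epsilon> unfolding conv_def null_def by (intro eventually_conj eventually_ge_at_top) auto
  then obtain d where d: "small b (\<epsilon>/2) (\<sigma> d - subst Const (X a (d\<^sup>2)) p)" "d \<ge> 1"
    using eventually_happens' [OF sequentially_bot] by blast
  have Q: "Q (d\<^sup>2)" using PQ(2) d(2) by (simp add: eventually_principal)
  have "small b (\<epsilon>/2 + \<epsilon>/2) (\<sigma> d - p)"
    using small_add [OF d(1) PQ(3) [OF a(1) Q]] b \<epsilon> by simp
  then have "small b \<epsilon> (p - \<sigma> d)"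
    using small_uminus_iff [of b \<epsilon> "\<sigma> d - p"] by simp
  then obtain r where r: "\<And>s. r \<le> s \<Longrightarrow> sum_of_squares (p - \<sigma> d + Const \<epsilon> * \<theta> s)"
    using small_imp_sos [of b \<epsilon> "p - \<sigma> d"] b \<epsilon> by auto
  show thesis
  proof (rule that [of r])
    fix s assume "r \<le> s"
    show "sum_of_squares (p + Const \<epsilon> * \<theta> s)"
      using sos_add [OF r [OF \<open>r \<le> s\<close>] \<sigma>(1) [of d]] by (simp add: algebra_simps)
  qed
qed

section \<open>The penalty parameter and the certificate\<close>

lemma eval_theta: "eval (\<theta> r) x = (\<Sum>k\<le>r. \<Sum>i\<in>UNIV. x i ^ (2 * k) / fact k)"
  by (simp add: \<theta>_def eval_simps)

lemma eval_theta_ge: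
  fixes x :: "'v::finite \<Rightarrow> real"
  assumes "k \<le> r"
  shows "x i ^ (2 * k) / fact k \<le> eval (\<theta> r) x"
proof -
  have nn: "0 \<le> x j ^ (2 * l) / fact l" for j l by (simp add: power_mult)
  have "x i ^ (2 * k) / fact k \<le> (\<Sum>i\<in>UNIV. x i ^ (2 * k) / fact k)"
    by (rule member_le_sum) (use nn in auto)
  also have "\<dots> \<le> (\<Sum>k\<le>r. \<Sum>i\<in>UNIV. x i ^ (2 * k) / fact k)"
    by (rule member_le_sum) (use assms nn in \<open>auto intro: sum_nonneg\<close>)
  finally show ?thesis by (simp add: eval_theta)
qed

lemma eval_theta_ge_1: "1 \<le> eval (\<theta> r) (x :: 'v::finite \<Rightarrow> real)"
  using eval_theta_ge [of 0 r x] by simp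

lemma eval_bound:
  fixes F :: "'v::finite mpoly"
  obtains C D where "C \<ge> 0" "\<And>x M. M \<ge> 1 \<Longrightarrow> (\<And>i. \<bar>x i\<bar> \<le> M) \<Longrightarrow> \<bar>eval F x\<bar> \<le> C * M ^ D"
proof -
  define C where "C = (\<Sum>t\<in>Poly_Mapping.keys F. \<bar>Poly_Mapping.lookup F t\<bar>)"
  \<comment> \<open>The sum of the degrees of all monomials is a crude bound for each of
    them.\<close>
  define D where "D = (\<Sum>t\<in>Poly_Mapping.keys F. \<Sum>i\<in>UNIV. Poly_Mapping.lookup t i)"
  show thesis
  proof
    show "C \<ge> 0" by (simp add: C_def sum_nonneg)
    fix x :: "'v \<Rightarrow> real" and M :: real
    assume M: "M \<ge> 1" and x: "\<And>i. \<bar>x i\<bar> \<le> M"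
    have "\<bar>eval F x\<bar> \<le> (\<Sum>t\<in>Poly_Mapping.keys F. \<bar>Poly_Mapping.lookup F t\<bar> *
        (\<Prod>i\<in>UNIV. \<bar>x i\<bar> ^ Poly_Mapping.lookup t i))"
      unfolding eval_def subst_def prod_keys_UNIV
      by (rule order.trans [OF sum_abs]) (simp add: abs_mult abs_prod power_abs)
    also have "\<dots> \<le> (\<Sum>t\<in>Poly_Mapping.keys F. \<bar>Poly_Mapping.lookup F t\<bar> * M ^ D)"
    proof (intro sum_mono mult_left_mono)
      fix t assume t: "t \<in> Poly_Mapping.keys F"
      have "(\<Prod>i\<in>UNIV. \<bar>x i\<bar> ^ Poly_Mapping.lookup t i) \<le> (\<Prod>i\<in>UNIV. M ^ Poly_Mapping.lookup t i)"
        using x by (intro prod_mono conjI power_mono) auto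
      also have "\<dots> = M ^ (\<Sum>i\<in>UNIV. Poly_Mapping.lookup t i)"
        by (simp add: power_sum)
      also have "\<dots> \<le> M ^ D"
        unfolding D_def by (intro power_increasing M member_le_sum t) auto
      finally show "(\<Prod>i\<in>UNIV. \<bar>x i\<bar> ^ Poly_Mapping.lookup t i) \<le> M ^ D" .
    qed simp
    also have "\<dots> = C * M ^ D" by (simp add: C_def sum_distrib_right)
    finally show "\<bar>eval F x\<bar> \<le> C * M ^ D" .
  qed
qed

lemma theta_coercive:
  fixes F :: "'v::finite mpoly"
  assumes "\<epsilon> > 0"
  obtains r R where "\<And>x i. \<bar>x i\<bar> > R \<Longrightarrow> eval F x + \<epsilon> * eval (\<theta> r) x > 0"
proof -
  obtain C D where C: "C \<ge> 0" and
    F: "\<And>x M. M \<ge> 1 \<Longrightarrow> (\<And>i. \<bar>x i\<bar> \<le> M) \<Longrightarrow> \<bar>eval F x\<bar> \<le> C * M ^ D"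
    using eval_bound by blast
  \<comment> \<open>The term of \<theta> of degree \<open>2 * r\<close> in the largest coordinate M
    beats C M^D: beyond \<open>R\<close> one has C r! < \<epsilon> M \<le> \<epsilon> M^r, and
    multiplying by M^r gives the claim.\<close>
  define r where "r = Suc D"
  define R where "R = max 1 (C * fact r / \<epsilon>)"
  show thesis
  proof (rule that [of R r])
    fix x :: "'v \<Rightarrow> real" and i assume i: "\<bar>x i\<bar> > R"
    define M where "M = Max (range (\<lambda>i. \<bar>x i\<bar>))"
    have M_ge: "\<bar>x j\<bar> \<le> M" for j by (simp add: M_def)
    have "M \<in> range (\<lambda>i. \<bar>x i\<bar>)" unfolding M_def by (rule Max_in) auto
    then obtain k where k: "M = \<bar>x k\<bar>" by auto
    have MR: "M > R" using M_ge [of i] i by simp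
    then have M1: "M \<ge> 1" "C * fact r / \<epsilon> < M" by (auto simp: R_def)
    have "C * fact r < \<epsilon> * M" using M1(2) assms by (simp add: field_simps)
    also have "\<epsilon> * M \<le> \<epsilon> * M ^ r"
      using M1(1) assms power_increasing [of 1 r M] by (simp add: r_def)
    finally have "C * fact r < \<epsilon> * M ^ r" .
    then have "C * fact r * M ^ r < \<epsilon> * M ^ r * M ^ r"
      using M1(1) by (intro mult_strict_right_mono) auto
    then have "C * M ^ r < \<epsilon> * (x k ^ (2 * r) / fact r)"
      by (simp add: k field_simps power_mult power2_eq_square power_mult_distrib flip: power_abs)
    also have "\<dots> \<le> \<epsilon> * eval (\<theta> r) x"
      using assms by (intro mult_left_mono eval_theta_ge) auto
    finally have "C * M ^ r < \<epsilon> * eval (\<theta> r) x" .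
    moreover have "\<bar>eval F x\<bar> \<le> C * M ^ D" by (rule F [OF M1(1) M_ge])
    moreover have "C * M ^ D \<le> C * M ^ r"
      using C M1(1) by (intro mult_left_mono power_increasing) (auto simp: r_def)
    ultimately show "eval F x + \<epsilon> * eval (\<theta> r) x > 0" by linarith
  qed
qed

lemma continuous_on_eval: "continuous_on S (\<lambda>x :: real^'v::finite. eval p (($) x))"
  unfolding eval_def subst_def by (intro continuous_intros)

text \<open>By coercivity, the set \<open>K\<close> where F + \<epsilon> \<theta> is not positive is
  compact. There H cannot vanish, since otherwise F \<ge> 0 and \<theta> \<ge> 1 would make the sum
  positive; so H has a positive minimum on \<open>K\<close>. Off \<open>K\<close> any nonnegative
  penalty works.\<close>

lemma penalty_nonneg:
  fixes F H :: "'v::finite mpoly"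
  assumes H: "\<And>x. eval H x \<ge> 0" and FH: "\<And>x. eval H x = 0 \<Longrightarrow> eval F x \<ge> 0" and \<epsilon>: "\<epsilon> > 0"
  obtains r l where "l \<ge> 0" "\<And>x. eval F x + \<epsilon> * eval (\<theta> r) x + l * eval H x \<ge> 0"
proof -
  obtain r R where rR: "\<And>x i. \<bar>x i\<bar> > R \<Longrightarrow> eval F x + \<epsilon> * eval (\<theta> r) x > 0"
    by (rule theta_coercive [OF \<epsilon>, of F]) blast
  define G where "G x = eval F x + \<epsilon> * eval (\<theta> r) x" for x
  define K where "K = {x :: real^'v. G (($) x) \<le> 0}"
  have contG: "continuous_on S (\<lambda>x. G (($) x))" for S
    unfolding G_def by (intro continuous_intros continuous_on_eval)
  have "K \<subseteq> cbox (\<chi> i. - R) (\<chi> i. R)"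
  proof
    fix x assume "x \<in> K"
    then have "\<bar>x $ i\<bar> \<le> R" for i
      using rR [of "($) x" i] by (force simp: K_def G_def)
    then show "x \<in> cbox (\<chi> i. - R) (\<chi> i. R)"
      by (auto simp: mem_box_cart abs_le_iff minus_le_iff)
  qed
  then have "bounded K" using bounded_cbox bounded_subset by blast
  moreover have "closed K"
    unfolding K_def by (intro closed_Collect_le contG continuous_intros)
  ultimately have compact: "compact K" by (simp add: compact_eq_bounded_closed)
  have eq: "($) (\<chi> i. x i) = x" for x :: "'v \<Rightarrow> real" by auto
  show thesis
  proof (cases "K = {}")
    case True
    then have "(\<chi> i. x i) \<notin> K" for x by simp
    then have "G x > 0" for x
      by (simp add: K_def eq not_le)
    then show thesis
      by (intro that [of 0 r]) (auto simp: G_def less_imp_le)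
  next
    case False
    obtain x0 where x0: "x0 \<in> K" "\<And>x. x \<in> K \<Longrightarrow> eval H (($) x0) \<le> eval H (($) x)"
      using continuous_attains_inf [OF compact False continuous_on_eval] by blast
    obtain x1 where x1: "x1 \<in> K" "\<And>x. x \<in> K \<Longrightarrow> G (($) x1) \<le> G (($) x)"
      using continuous_attains_inf [OF compact False contG] by blast
    have "eval H (($) x0) \<noteq> 0"
    proof
      assume "eval H (($) x0) = 0"
      then have "eval F (($) x0) \<ge> 0" by (rule FH)
      moreover have "\<epsilon> * eval (\<theta> r) (($) x0) > 0"
        using \<epsilon> eval_theta_ge_1 [of r "($) x0"] by (intro mult_pos_pos) auto
      ultimately show False using x0(1) by (simp add: K_def G_def)
    qed
    then have H0: "eval H (($) x0) > 0" using H [of "($) x0"] by simp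
    \<comment> \<open>The minimum of G over \<open>K\<close>, negated, divided by the minimum of H
      over \<open>K\<close>: the penalty then outweighs G at every point of
      \<open>K\<close>.\<close>
    define l where "l = - G (($) x1) / eval H (($) x0)"
    have l: "l \<ge> 0" using x1(1) H0 by (simp add: l_def K_def divide_nonpos_pos)
    show thesis
    proof (rule that [OF l])
      fix x
      show "eval F x + \<epsilon> * eval (\<theta> r) x + l * eval H x \<ge> 0"
      proof (cases "(\<chi> i. x i) \<in> K")
        case True
        have "- G (($) x1) = l * eval H (($) x0)" using H0 by (simp add: l_def)
        also have "\<dots> \<le> l * eval H x"
          using x0(2) [OF True] l unfolding eq by (intro mult_left_mono)
        finally show ?thesis using x1(2) [OF True] unfolding eq by (simp add: G_def)
      next
        case False
        then show ?thesis using l H [of x] by (simp add: K_def eq G_def not_le less_imp_le)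
      qed
    qed
  qed
qed

section \<open>Assembling the certificate\<close>

lemma theta_phi_join: "in_x (\<theta> r) + in_z (\<phi> r) = (\<theta> r :: ('n::finite + 'm::finite) mpoly)"
  by (simp add: \<theta>_def \<phi>_def rename_simps sum.distrib [symmetric] UNIV_Plus_UNIV [symmetric]
      sum.Plus del: UNIV_Plus_UNIV)

text \<open>At z_j = sqrt (g_j(x)) every penalty term vanishes and z_j^(2 k) becomes g_j(x)^k;
  nonnegativity of g_j on the feasible set makes the square root exact.\<close>

lemma certificate_eval:
  fixes f :: "'n::finite mpoly" and g :: "'m::finite \<Rightarrow> 'n mpoly"
  assumes cert: "certificate f g \<epsilon> l r q" and x: "x \<in> feasible_set g"
  shows "eval f (($) x)
      + \<epsilon> * (\<Sum>k\<le>r. \<Sum>i\<in>UNIV. (x $ i) ^ (2 * k) / fact k)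
      + \<epsilon> * (\<Sum>k\<le>r. \<Sum>j\<in>UNIV. eval (g j) (($) x) ^ k / fact k)
    = eval q (case_sum (($) x) (\<lambda>j. sqrt (eval (g j) (($) x))))"
proof -
  define a where "a = case_sum (($) x) (\<lambda>j. sqrt (eval (g j) (($) x)))"
  have sq: "(sqrt (eval (g j) (($) x)))\<^sup>2 = eval (g j) (($) x)" for j
    using x by (simp add: feasible_set_def)
  have "eval (in_x f + Const \<epsilon> * in_x (\<theta> r) + Const \<epsilon> * in_z (\<phi> r)) a =
      eval (q - (\<Sum>j\<in>UNIV. Const (l j) * (in_x (g j) - (Var (Inr j))\<^sup>2)\<^sup>2)) a"
    using cert by (simp add: certificate_def)
  then show ?thesis
    by (simp add: eval_simps eval_rename \<theta>_def \<phi>_def a_def sq power_mult)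
qed

theorem corollary4p3:
  fixes f :: "'n::finite mpoly"
    and g :: "'m::finite \<Rightarrow> 'n mpoly"
    and \<epsilon> :: real
  assumes "\<And>x. x \<in> feasible_set g \<Longrightarrow> eval f (($) x) \<ge> 0"
    and "\<epsilon> > 0"
  shows "\<exists>l :: 'm \<Rightarrow> real. (\<forall>j. l j \<ge> 0) \<and>
    (\<forall>\<^sub>F r in sequentially. \<exists>q. sum_of_squares q \<and> certificate f g \<epsilon> l r q) \<and>
    (\<forall>r q. sum_of_squares q \<and> certificate f g \<epsilon> l r q \<longrightarrow>
      (\<forall>x \<in> feasible_set g.
        eval f (($) x)
          + \<epsilon> * (\<Sum>k\<le>r. \<Sum>i\<in>UNIV. (x $ i) ^ (2 * k) / fact k)
          + \<epsilon> * (\<Sum>k\<le>r. \<Sum>j\<in>UNIV. eval (g j) (($) x) ^ k / fact k)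
        = eval q (case_sum (($) x) (\<lambda>j. sqrt (eval (g j) (($) x)))) \<and>
        eval q (case_sum (($) x) (\<lambda>j. sqrt (eval (g j) (($) x)))) \<ge> 0))"
proof -
  define H :: "('n + 'm) mpoly" where "H = (\<Sum>j\<in>UNIV. (in_x (g j) - (Var (Inr j))\<^sup>2)\<^sup>2)"
  have evalH: "eval H a = (\<Sum>j\<in>UNIV. (eval (g j) (\<lambda>i. a (Inl i)) - (a (Inr j))\<^sup>2)\<^sup>2)" for a
    by (simp add: H_def eval_simps eval_rename)
  have H: "eval H a \<ge> 0" for a
    by (simp add: evalH sum_nonneg)
  have fH: "eval (in_x f) a \<ge> 0" if "eval H a = 0" for a
  proof -
    \<comment> \<open>A zero of the penalty has g_j(x) = z_j^2 \<ge> 0 for all j, so its x-part is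
      feasible.\<close>
    have "eval (g j) (\<lambda>i. a (Inl i)) = (a (Inr j))\<^sup>2" for j
      using that unfolding evalH by (subst (asm) sum_nonneg_eq_0_iff) auto
    moreover have eq: "($) (\<chi> i. a (Inl i)) = (\<lambda>i. a (Inl i))" by auto
    ultimately have "(\<chi> i. a (Inl i)) \<in> feasible_set g"
      by (simp add: feasible_set_def)
    from assms(1) [OF this] show ?thesis unfolding eq by (simp add: eval_rename)
  qed
  obtain r1 l where l: "l \<ge> 0"
    and nonneg: "\<And>a. eval (in_x f) a + \<epsilon>/2 * eval (\<theta> r1) a + l * eval H a \<ge> 0"
  proof (rule penalty_nonneg [OF H fH])
    show "\<epsilon>/2 > 0" using assms(2) by simp
  qed (assumption, rule that)
  \<comment> \<open>Half of \<epsilon> is spent at the fixed order \<open>r1\<close> to make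
    \<open>P\<close> nonnegative; the other half remains for turning \<open>P\<close> into a sum of
    squares.\<close>
  define P where "P = in_x f + Const (\<epsilon>/2) * \<theta> r1 + Const l * H"
  have "eval P a \<ge> 0" for a
    using nonneg [of a] by (simp add: P_def eval_simps)
  then obtain r2 where r2: "\<And>r. r2 \<le> r \<Longrightarrow> sum_of_squares (P + Const (\<epsilon>/2) * \<theta> r)"
    using nonneg_perturbation_sos [of P "\<epsilon>/2"] assms(2) by auto
  have "\<exists>q. sum_of_squares q \<and> certificate f g \<epsilon> (\<lambda>_. l) r q" if "max r1 r2 \<le> r" for r
  proof (intro exI conjI)
    \<comment> \<open>With the full \<epsilon> at order \<open>r\<close>, \<open>q\<close> exceeds
      the sum of squares obtained from \<open>P\<close> by \<epsilon>/2 times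
      \<open>\<theta> r - \<theta> r1\<close>, itself a sum of squares for
      \<open>r1 \<le> r\<close>. The multiplier \<open>l\<close> is the same for all constraints and
      does not depend on \<open>r\<close>.\<close>
    define q where "q = in_x f + Const \<epsilon> * \<theta> r + Const l * H"
    have "Const \<epsilon> = Const (\<epsilon>/2) + (Const (\<epsilon>/2) :: ('n + 'm) mpoly)"
      by (simp flip: Const_add)
    then have "q = P + Const (\<epsilon>/2) * \<theta> r + Const (\<epsilon>/2) * (\<theta> r - \<theta> r1)"
      by (simp add: q_def P_def algebra_simps)
    moreover have "sum_of_squares (\<theta> r - \<theta> r1 :: ('n + 'm) mpoly)"
      using theta_mono [of r1 r] that by (simp add: sos_le_def)
    ultimately show "sum_of_squares q"
      using that r2 [of r] assms(2) by (auto intro!: sos_intros)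
    show "certificate f g \<epsilon> (\<lambda>_. l) r q"
      by (simp add: certificate_def q_def H_def theta_phi_join [symmetric] sum_distrib_left algebra_simps)
  qed
  then have "\<forall>\<^sub>F r in sequentially. \<exists>q. sum_of_squares q \<and> certificate f g \<epsilon> (\<lambda>_. l) r q"
    using eventually_sequentially by blast
  then show ?thesis
    using l by (intro exI [of _ "\<lambda>_. l"]) (auto simp: certificate_eval sos_eval_nonneg)
qed

end
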